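(* Let $\Omega\subset\mathbb{C}^n$ be a bounded domain with Bergman kernel $\mathcal{B}$, and let $\Phi:\Omega\to\mathcal{P}(\Omega,dV)$, $\Phi(z)=\frac{|\mathcal{B}(z,\xi)|^2}{\mathcal{B}(z,z)}\,dV(\xi)$. Then $\Phi$ is the composition $$\Omega\xrightarrow{\ \iota_\Omega\ }\mathbb{P}(A^2(\Omega)^* )\xrightarrow[\cong]{\ \varphi\ }\mathbb{P}(A^2(\Omega))\xrightarrow{\ \phi\ }\mathcal{P}(\Omega,dV),$$ i.e. $\Phi=\phi\circ\varphi\circ\iota_\Omega$.
   Context: $A^2(\Omega)$ is the Hilbert space of $L^2$ holomorphic functions on $\Omega$ with inner product $\langle f,g\rangle=\int_\Omega f\overline g\,dV$ ($dV$ Lebesgue measure), $\{s_j\}_{j\ge0}$ is an orthonormal basis, $\mathcal{B}(z,\xi)=\sum_js_j(z)\overline{s_j(\xi)}$, and $\mathbb{P}(\cdot)$ denotes projectivization. $\mathcal{P}(\Omega,dV)$ is the set of probability measures $\rho\,dV$ with $\rho\in L^1(\Omega,dV)$, $\rho>0$ a.e. $\iota_\Omega$ is the Bergman–Bochner map $z\mapsto[s_0(z),s_1(z),\dots]$, i.e. $z\mapsto\big[\sum_js_j(z)\langle\cdot,s_j\rangle\big]$. $\varphi$ is induced by the (conjugate-linear) isomorphism $A^2(\Omega)^*\to A^2(\Omega)$, $\sum_ja_j\langle\cdot,s_j\rangle\mapsto\sum_j\overline{a_j}s_j$. $\phi$ is the map $[s]\mapsto\frac{|s|^2}{\|s\|^2_{L^2(\Omega,dV)}}\,dV$.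 *)

theory Defs
  imports "HOL-Probability.Probability_Measure"
begin

definition domain_Cn :: "(complex ^ 'n) set \<Rightarrow> bool" where
  "domain_Cn \<Omega> \<longleftrightarrow> open \<Omega> \<and> connected \<Omega> \<and> \<Omega> \<noteq> {}"

(* has_derivative asks for a real-linear derivative; holomorphy is its complex homogeneity. *)
definition holomorphic_Cn :: "(complex ^ 'n \<Rightarrow> complex) \<Rightarrow> (complex ^ 'n) set \<Rightarrow> bool" where
  "holomorphic_Cn f \<Omega> \<longleftrightarrow>
     (\<forall>z\<in>\<Omega>. \<exists>f'. (f has_derivative f') (at z) \<and> (\<forall>c v. f' (c *s v) = c * f' v))"

section \<open>The Bergman space and its dual\<close>

(* A function on \<Omega> is represented by its extension by 0 to all of C^n, so that equality of
   HOL functions is equality on \<Omega>; functionals are likewise extended by 0 off A2 \<Omega>. *)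
definition A2 :: "(complex ^ 'n) set \<Rightarrow> (complex ^ 'n \<Rightarrow> complex) set" where
  "A2 \<Omega> = {f. holomorphic_Cn f \<Omega> \<and> integrable (lebesgue_on \<Omega>) (\<lambda>z. (cmod (f z))\<^sup>2) \<and>
              (\<forall>z. z \<notin> \<Omega> \<longrightarrow> f z = 0)}"

definition A2_inner ::
    "(complex ^ 'n) set \<Rightarrow> (complex ^ 'n \<Rightarrow> complex) \<Rightarrow> (complex ^ 'n \<Rightarrow> complex) \<Rightarrow> complex" where
  "A2_inner \<Omega> f g = integral\<^sup>L (lebesgue_on \<Omega>) (\<lambda>z. f z * cnj (g z))"

definition L2_norm_on :: "(complex ^ 'n) set \<Rightarrow> (complex ^ 'n \<Rightarrow> complex) \<Rightarrow> real" where
  "L2_norm_on \<Omega> f = sqrt (integral\<^sup>L (lebesgue_on \<Omega>) (\<lambda>z. (cmod (f z))\<^sup>2))"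

definition A2_dual :: "(complex ^ 'n) set \<Rightarrow> ((complex ^ 'n \<Rightarrow> complex) \<Rightarrow> complex) set" where
  "A2_dual \<Omega> = {L. (\<forall>f\<in>A2 \<Omega>. \<forall>g\<in>A2 \<Omega>. L (\<lambda>z. f z + g z) = L f + L g) \<and>
                   (\<forall>c. \<forall>f\<in>A2 \<Omega>. L (\<lambda>z. c * f z) = c * L f) \<and>
                   (\<exists>C. \<forall>f\<in>A2 \<Omega>. cmod (L f) \<le> C * L2_norm_on \<Omega> f) \<and>
                   (\<forall>f. f \<notin> A2 \<Omega> \<longrightarrow> L f = 0)}"

definition dual_norm :: "(complex ^ 'n) set \<Rightarrow> ((complex ^ 'n \<Rightarrow> complex) \<Rightarrow> complex) \<Rightarrow> real" where
  "dual_norm \<Omega> L = (SUP f\<in>{f \<in> A2 \<Omega>. L2_norm_on \<Omega> f \<le> 1}. cmod (L f))"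

definition A2_sums ::
    "(complex ^ 'n) set \<Rightarrow> (nat \<Rightarrow> complex ^ 'n \<Rightarrow> complex) \<Rightarrow> (complex ^ 'n \<Rightarrow> complex) \<Rightarrow> bool" where
  "A2_sums \<Omega> u g \<longleftrightarrow> g \<in> A2 \<Omega> \<and>
     (\<lambda>N. L2_norm_on \<Omega> (\<lambda>z. g z - (\<Sum>j<N. u j z))) \<longlonglongrightarrow> 0"

definition dual_sums ::
    "(complex ^ 'n) set \<Rightarrow> (nat \<Rightarrow> (complex ^ 'n \<Rightarrow> complex) \<Rightarrow> complex) \<Rightarrow>
     ((complex ^ 'n \<Rightarrow> complex) \<Rightarrow> complex) \<Rightarrow> bool" where
  "dual_sums \<Omega> U L \<longleftrightarrow> L \<in> A2_dual \<Omega> \<and>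
     (\<lambda>N. dual_norm \<Omega> (\<lambda>f. L f - (\<Sum>j<N. U j f))) \<longlonglongrightarrow> 0"

(* The last conjunct is density of the linear span. *)
definition orthonormal_basis_A2 ::
    "(complex ^ 'n) set \<Rightarrow> (nat \<Rightarrow> complex ^ 'n \<Rightarrow> complex) \<Rightarrow> bool" where
  "orthonormal_basis_A2 \<Omega> s \<longleftrightarrow>
     (\<forall>j. s j \<in> A2 \<Omega>) \<and>
     (\<forall>i j. A2_inner \<Omega> (s i) (s j) = (if i = j then 1 else 0)) \<and>
     (\<forall>f\<in>A2 \<Omega>. \<forall>\<epsilon>>0. \<exists>N c. L2_norm_on \<Omega> (\<lambda>z. f z - (\<Sum>j<N. c j * s j z)) < \<epsilon>)"

section \<open>Projectivization\<close>

definition proj_class :: "('a \<Rightarrow> complex) \<Rightarrow> ('a \<Rightarrow> complex) set" where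
  "proj_class v = {(\<lambda>x. c * v x) | c. c \<noteq> 0}"

definition projectivization :: "('a \<Rightarrow> complex) set \<Rightarrow> ('a \<Rightarrow> complex) set set" where
  "projectivization V = proj_class ` (V - {\<lambda>_. 0})"

(* The map [v] \<mapsto> F v; it is meaningful on classes on which F is constant. *)
definition on_classes :: "(('a \<Rightarrow> complex) \<Rightarrow> 'b) \<Rightarrow> ('a \<Rightarrow> complex) set \<Rightarrow> 'b" where
  "on_classes F X = the_elem (F ` X)"

definition conj_linear_iso ::
    "('a \<Rightarrow> complex) set \<Rightarrow> ('b \<Rightarrow> complex) set \<Rightarrow> (('a \<Rightarrow> complex) \<Rightarrow> ('b \<Rightarrow> complex)) \<Rightarrow> bool" where
  "conj_linear_iso V W J \<longleftrightarrow> bij_betw J V W \<and>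
     (\<forall>u\<in>V. \<forall>v\<in>V. J (\<lambda>x. u x + v x) = (\<lambda>y. J u y + J v y)) \<and>
     (\<forall>c. \<forall>v\<in>V. J (\<lambda>x. c * v x) = (\<lambda>y. cnj c * J v y))"

section \<open>The maps\<close>

definition prob_densities :: "(complex ^ 'n) set \<Rightarrow> (complex ^ 'n) measure set" where
  "prob_densities \<Omega> = {M. prob_space M \<and>
     (\<exists>\<rho> :: complex ^ 'n \<Rightarrow> real. integrable (lebesgue_on \<Omega>) \<rho> \<and> (AE \<xi> in lebesgue_on \<Omega>. \<rho> \<xi> > 0) \<and>
          M = density (lebesgue_on \<Omega>) (\<lambda>\<xi>. ennreal (\<rho> \<xi>)))}"

definition bergman_kernel ::
    "(nat \<Rightarrow> complex ^ 'n \<Rightarrow> complex) \<Rightarrow> complex ^ 'n \<Rightarrow> complex ^ 'n \<Rightarrow> complex" where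
  "bergman_kernel s z \<xi> = (\<Sum>j. s j z * cnj (s j \<xi>))"

(* On the diagonal the kernel is the sum of |s_j(z)|^2, hence real; Re only changes the type. *)
definition Phi_map ::
    "(complex ^ 'n) set \<Rightarrow> (nat \<Rightarrow> complex ^ 'n \<Rightarrow> complex) \<Rightarrow> complex ^ 'n \<Rightarrow> (complex ^ 'n) measure" where
  "Phi_map \<Omega> s z = density (lebesgue_on \<Omega>)
     (\<lambda>\<xi>. ennreal ((cmod (bergman_kernel s z \<xi>))\<^sup>2 / Re (bergman_kernel s z z)))"

definition inner_functional ::
    "(complex ^ 'n) set \<Rightarrow> (complex ^ 'n \<Rightarrow> complex) \<Rightarrow> (complex ^ 'n \<Rightarrow> complex) \<Rightarrow> complex" where
  "inner_functional \<Omega> g = (\<lambda>f. if f \<in> A2 \<Omega> then A2_inner \<Omega> f g else 0)"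

definition bergman_bochner ::
    "(complex ^ 'n) set \<Rightarrow> (nat \<Rightarrow> complex ^ 'n \<Rightarrow> complex) \<Rightarrow> complex ^ 'n \<Rightarrow>
     ((complex ^ 'n \<Rightarrow> complex) \<Rightarrow> complex) set" where
  "bergman_bochner \<Omega> s z =
     proj_class (THE L. dual_sums \<Omega> (\<lambda>j f. s j z * inner_functional \<Omega> (s j) f) L)"

(* Sends the sum of a_j <.,s_j> (in the dual norm) to the sum of cnj(a_j) s_j (in L^2). *)
definition dual_iso ::
    "(complex ^ 'n) set \<Rightarrow> (nat \<Rightarrow> complex ^ 'n \<Rightarrow> complex) \<Rightarrow>
     ((complex ^ 'n \<Rightarrow> complex) \<Rightarrow> complex) \<Rightarrow> complex ^ 'n \<Rightarrow> complex" where
  "dual_iso \<Omega> s L = (THE g. \<exists>a :: nat \<Rightarrow> complex.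
     dual_sums \<Omega> (\<lambda>j f. a j * inner_functional \<Omega> (s j) f) L \<and>
     A2_sums \<Omega> (\<lambda>j z. cnj (a j) * s j z) g)"

definition varphi_map ::
    "(complex ^ 'n) set \<Rightarrow> (nat \<Rightarrow> complex ^ 'n \<Rightarrow> complex) \<Rightarrow>
     ((complex ^ 'n \<Rightarrow> complex) \<Rightarrow> complex) set \<Rightarrow> (complex ^ 'n \<Rightarrow> complex) set" where
  "varphi_map \<Omega> s = on_classes (\<lambda>L. proj_class (dual_iso \<Omega> s L))"

definition phi_map ::
    "(complex ^ 'n) set \<Rightarrow> (complex ^ 'n \<Rightarrow> complex) set \<Rightarrow> (complex ^ 'n) measure" where
  "phi_map \<Omega> = on_classes (\<lambda>f. density (lebesgue_on \<Omega>)
     (\<lambda>\<xi>. ennreal ((cmod (f \<xi>))\<^sup>2 / (L2_norm_on \<Omega> f)\<^sup>2)))"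

end

theory Submission
  imports Defs "HOL-Complex_Analysis.Complex_Analysis"
begin

text \<open>
  Point evaluations are bounded on the Bergman space, by the mean value property of \<open>f\<^sup>2\<close> on balls.
  Hence \<open>L\<^sup>2\<close> convergence is locally uniform, limits stay holomorphic, and the Riesz representation
  \<open>g \<mapsto> \<langle>\<cdot>, g\<rangle>\<close> is an isometry from \<open>A\<^sup>2(\<Omega>)\<close> onto its dual that turns expansions with coefficients
  \<open>cnj a\<^sub>j\<close> into expansions with coefficients \<open>a\<^sub>j\<close>; the conjugate-linear isomorphism of the statement is its inverse.
  The functional \<open>\<Sum>\<^sub>j s\<^sub>j(z) \<langle>\<cdot>, s\<^sub>j\<rangle>\<close> is evaluation at \<open>z\<close>, represented by the function \<open>k\<close> with
  \<open>B(z, \<xi>) = cnj (k \<xi>)\<close> and \<open>\<parallel>k\<parallel>\<^sup>2 = k z = B(z, z)\<close>, which gives the factorization.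
  The densities are positive almost everywhere since zero sets of holomorphic functions are null.
\<close>

section \<open>Invariance of Lebesgue measure\<close>

text \<open>The function theory in several variables is reached by slicing with complex lines
  through a point, so each analytic input is a one-variable fact. The price is that the slices must
  be reassembled into an integral over a ball: averaging over unimodular scalars does this, which is
  why an invariance property of the measure comes first. Slices in all directions also give Cauchy
  estimates for the full derivative. Completeness is needed for series in the given basis. There the
  locally uniform limit is a genuine holomorphic function and Fatou's lemma shows that it is also
  the limit in norm, so all arguments deal with functions and not with classes modulo null sets. The
  Bergman-Bochner map and the conjugate-linear isomorphism are definite descriptions ranging over
  infinite expansions. Their uniqueness is settled in \<open>A2 \<Omega>\<close>, where convergence
  in norm forces convergence at every point. Boundedness of \<Omega> puts the constants into the
  Bergman space. Hence evaluation at a point is a nonzero functional and has a projective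
  class.\<close>

lemma emeasure_lborel_ball_pos:
  fixes x :: "'a::euclidean_space"
  assumes "0 < r"
  shows "0 < emeasure lborel (ball x r)"
  using assms open_not_negligible[of "ball x r"]
  by (auto simp: negligible_iff_emeasure0 zero_less_iff_neq_zero)

text \<open>A uniqueness argument of Haar type, free of determinants. With A the unit ball, which T
  preserves, the double integral of 1_A(Tx) 1_B(Tx+y) is |A||B| when y is integrated first. The
  translation of x by \<open>T' y\<close> and a second use of Fubini turn it into |A| times the
  measure of the preimage of B. The factor |A| is positive and finite and cancels.\<close>

lemma distr_lborel_linear_isometry:
  fixes T T' :: "'a::euclidean_space \<Rightarrow> 'a"
  assumes lin: "linear T" and iso: "\<And>x. norm (T x) = norm x"
    and inv: "\<And>x. T (T' x) = x"
  shows "distr lborel borel T = lborel"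
proof (rule measure_eqI)
  show "sets (distr lborel borel T) = sets lborel" by simp
next
  fix B assume "B \<in> sets (distr lborel borel T)"
  then have B[measurable]: "B \<in> sets borel" by simp
  have contT: "continuous_on UNIV T"
    using lin by (simp add: linear_continuous_on linear_conv_bounded_linear)
  have T[measurable]: "T \<in> borel_measurable borel"
    using contT by (rule borel_measurable_continuous_onI)
  let ?A = "ball 0 1 :: 'a set"
  have A[measurable]: "?A \<in> sets borel" by simp
  have trans: "(\<integral>\<^sup>+y. h (x + y) \<partial>lborel) = (\<integral>\<^sup>+y. h y \<partial>lborel)"
    if [measurable]: "h \<in> borel_measurable borel" for x and h :: "'a \<Rightarrow> ennreal"
    by (subst (2) lborel_distr_plus[of x, symmetric]) (simp add: nn_integral_distr)
  \<comment> \<open>The ball is symmetric about 0, so y -> x - y reduces to a translation.\<close>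
  have reflect: "(\<integral>\<^sup>+y. indicator ?A (x - y) \<partial>lborel) = emeasure lborel ?A" for x
  proof -
    have "(\<integral>\<^sup>+y. indicator ?A (x - y) \<partial>lborel) = (\<integral>\<^sup>+y. indicator ?A (- x + y) \<partial>lborel)"
      by (intro nn_integral_cong) (auto simp: indicator_def dist_norm norm_minus_commute)
    also have "\<dots> = emeasure lborel ?A"
      by (subst trans[of "indicator ?A"]) (auto intro: borel_measurable_indicator)
    finally show ?thesis .
  qed
  have ind: "indicator ?A (T x) = (indicator ?A x :: ennreal)" for x
    using iso by (simp add: indicator_def)
  have "emeasure lborel ?A * emeasure lborel B
      = (\<integral>\<^sup>+x. indicator ?A (T x) * emeasure lborel B \<partial>lborel)"
    unfolding ind by (subst nn_integral_multc) (auto intro: borel_measurable_indicator)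
  also have "\<dots> = (\<integral>\<^sup>+x. (\<integral>\<^sup>+y. indicator ?A (T x) * indicator B (T x + y) \<partial>lborel) \<partial>lborel)"
    by (intro nn_integral_cong) (subst nn_integral_cmult, auto simp: trans)
  also have "\<dots> = (\<integral>\<^sup>+y. (\<integral>\<^sup>+x. indicator ?A (T x) * indicator B (T x + y) \<partial>lborel) \<partial>lborel)"
    by (rule lborel_pair.Fubini') measurable
  also have "\<dots> = (\<integral>\<^sup>+y. (\<integral>\<^sup>+x. indicator ?A (T x - y) * indicator B (T x) \<partial>lborel) \<partial>lborel)"
  proof (rule nn_integral_cong)
    fix y
    have "(\<integral>\<^sup>+x. indicator ?A (T x - y) * indicator B (T x) \<partial>lborel)
       = (\<integral>\<^sup>+x. indicator ?A (T (T' y + x) - y) * indicator B (T (T' y + x)) \<partial>lborel)"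
      using trans[of "\<lambda>x. indicator ?A (T x - y) * indicator B (T x)" "T' y"] by simp
    also have "\<dots> = (\<integral>\<^sup>+x. indicator ?A (T x) * indicator B (T x + y) \<partial>lborel)"
      using lin inv by (simp add: linear_add add.commute)
    finally show "(\<integral>\<^sup>+x. indicator ?A (T x) * indicator B (T x + y) \<partial>lborel)
       = (\<integral>\<^sup>+x. indicator ?A (T x - y) * indicator B (T x) \<partial>lborel)" by simp
  qed
  also have "\<dots> = (\<integral>\<^sup>+x. (\<integral>\<^sup>+y. indicator ?A (T x - y) * indicator B (T x) \<partial>lborel) \<partial>lborel)"
    by (rule lborel_pair.Fubini') measurable
  also have "\<dots> = (\<integral>\<^sup>+x. emeasure lborel ?A * indicator B (T x) \<partial>lborel)"
    by (intro nn_integral_cong) (subst nn_integral_multc, auto simp: reflect)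
  also have "\<dots> = emeasure lborel ?A * emeasure (distr lborel borel T) B"
    by (subst nn_integral_cmult)
      (auto simp: nn_integral_distr[symmetric, of T lborel borel "indicator B"])
  finally have "emeasure lborel ?A * emeasure lborel B
      = emeasure lborel ?A * emeasure (distr lborel borel T) B" .
  moreover have "emeasure lborel ?A \<noteq> 0" "emeasure lborel ?A \<noteq> \<infinity>"
    using emeasure_lborel_ball_finite[of "0::'a" 1] emeasure_lborel_ball_pos[of 1 "0::'a"] by auto
  ultimately show "emeasure (distr lborel borel T) B = emeasure lborel B"
    by (simp add: ennreal_mult_cancel_left)
qed

lemma nn_integral_lborel_rotate:
  fixes h :: "complex ^ 'n \<Rightarrow> ennreal"
  assumes [measurable]: "h \<in> borel_measurable borel" and c: "cmod c = 1"
  shows "(\<integral>\<^sup>+w. h (c *s w) \<partial>lborel) = (\<integral>\<^sup>+w. h w \<partial>lborel)"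
proof -
  have lin: "linear (\<lambda>w::complex^'n. c *s w)"
    by (intro linearI) (simp_all add: vec_eq_iff algebra_simps)
  have "norm (c *s w) = norm w" for w :: "complex ^ 'n"
    using c by (simp add: norm_vec_def norm_mult)
  moreover have "c *s (inverse c *s w) = w" for w :: "complex ^ 'n"
    using c by (cases "c = 0") (auto simp: vec_eq_iff)
  ultimately have "distr lborel borel (\<lambda>w::complex^'n. c *s w) = lborel"
    using lin by (intro distr_lborel_linear_isometry[where T' = "\<lambda>w. inverse c *s w"])
  moreover have [measurable]: "(\<lambda>w::complex^'n. c *s w) \<in> borel_measurable borel"
    using lin by (intro borel_measurable_continuous_onI)
      (simp add: linear_continuous_on linear_conv_bounded_linear)
  ultimately show ?thesis
    by (metis (no_types) assms(1) measurable_lborel1 nn_integral_distr sets_lborel measurable_cong_sets)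
qed

lemma vector_smult_bounded_linear: "bounded_linear (\<lambda>\<zeta>. \<zeta> *s (w :: complex ^ 'n))"
  by (subst linear_conv_bounded_linear[symmetric], intro linearI)
    (simp_all add: vec_eq_iff algebra_simps)

lemma norm_vector_smult: "norm (c *s (w :: complex ^ 'n)) = cmod c * norm w"
  by (simp add: norm_vec_def norm_mult L2_set_right_distrib)

lemma vector_smult_scaleR: "c *\<^sub>R (w :: complex ^ 'n) = of_real c *s w"
  unfolding vec_eq_iff vector_scaleR_component vector_smult_component
  by (simp add: scaleR_conv_of_real)

section \<open>Holomorphic functions of several variables\<close>

lemma holomorphic_Cn_imp_continuous_on:
  "holomorphic_Cn f \<Omega> \<Longrightarrow> continuous_on \<Omega> f"
  unfolding holomorphic_Cn_def
  by (meson continuous_at_imp_continuous_on has_derivative_continuous)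

lemma holomorphic_Cn_subset: "holomorphic_Cn f \<Omega> \<Longrightarrow> U \<subseteq> \<Omega> \<Longrightarrow> holomorphic_Cn f U"
  unfolding holomorphic_Cn_def by blast

lemma holomorphic_Cn_add:
  assumes "holomorphic_Cn f \<Omega>" "holomorphic_Cn g \<Omega>"
  shows "holomorphic_Cn (\<lambda>z. f z + g z) \<Omega>"
  unfolding holomorphic_Cn_def
proof
  fix z assume "z \<in> \<Omega>"
  then obtain f' g' where f': "(f has_derivative f') (at z)" "\<And>c v. f' (c *s v) = c * f' v"
    and g': "(g has_derivative g') (at z)" "\<And>c v. g' (c *s v) = c * g' v"
    using assms unfolding holomorphic_Cn_def by meson
  show "\<exists>h'. ((\<lambda>z. f z + g z) has_derivative h') (at z) \<and> (\<forall>c v. h' (c *s v) = c * h' v)"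
    using f' g' by (intro exI[of _ "\<lambda>v. f' v + g' v"])
      (auto simp: algebra_simps intro: has_derivative_add)
qed

lemma holomorphic_Cn_cmult:
  assumes "holomorphic_Cn f \<Omega>"
  shows "holomorphic_Cn (\<lambda>z. c * f z) \<Omega>"
  unfolding holomorphic_Cn_def
proof
  fix z assume "z \<in> \<Omega>"
  then obtain f' where f': "(f has_derivative f') (at z)" "\<And>c v. f' (c *s v) = c * f' v"
    using assms unfolding holomorphic_Cn_def by meson
  show "\<exists>h'. ((\<lambda>z. c * f z) has_derivative h') (at z) \<and> (\<forall>a v. h' (a *s v) = a * h' v)"
    using f' by (intro exI[of _ "\<lambda>v. c * f' v"])
      (auto simp: algebra_simps intro: has_derivative_mult_right)
qed

text \<open>Homogeneity gives \<open>f' (\<zeta> *s w) = \<zeta> * f' w\<close>: the real derivative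
  of the slice is multiplication by a complex number, which is complex differentiability.\<close>

lemma holomorphic_Cn_slice_deriv:
  fixes z w :: "complex ^ 'n"
  assumes f': "(f has_derivative f') (at (z + \<zeta> *s w))" "\<And>c v. f' (c *s v) = c * f' v"
  shows "((\<lambda>\<zeta>. f (z + \<zeta> *s w)) has_field_derivative f' w) (at \<zeta>)"
proof -
  have "((\<lambda>\<zeta>. z + \<zeta> *s w) has_derivative (\<lambda>\<zeta>. \<zeta> *s w)) (at \<zeta>)"
    using has_derivative_add[OF has_derivative_const
        bounded_linear_imp_has_derivative[OF vector_smult_bounded_linear[of w]], of z "at \<zeta>"] by simp
  from has_derivative_compose[OF this f'(1)] show ?thesis
    by (simp add: has_field_derivative_def f'(2) mult.commute[of _ "f' w"])
qed

lemma holomorphic_Cn_slice: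
  assumes "holomorphic_Cn f \<Omega>" "\<And>\<zeta>. \<zeta> \<in> S \<Longrightarrow> z + \<zeta> *s w \<in> \<Omega>"
  shows "(\<lambda>\<zeta>. f (z + \<zeta> *s w)) holomorphic_on S"
  unfolding holomorphic_on_def
proof
  fix \<zeta> assume "\<zeta> \<in> S"
  then obtain f' where f': "(f has_derivative f') (at (z + \<zeta> *s w))" "\<And>c v. f' (c *s v) = c * f' v"
    using assms unfolding holomorphic_Cn_def by meson
  show "(\<lambda>\<zeta>. f (z + \<zeta> *s w)) field_differentiable at \<zeta> within S"
    using holomorphic_Cn_slice_deriv[OF f'] field_differentiable_at_within field_differentiable_def
    by blast
qed

text \<open>Cauchy's formula at the centre: the velocity of the unit circle is 2 pi i times its
  position, which cancels the denominator of the Cauchy kernel.\<close>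

lemma circle_mean_value:
  assumes "h holomorphic_on cball 0 1"
  shows "((\<lambda>t. h (cis (2 * pi * t))) has_integral h 0) {0..1}"
proof -
  have "((\<lambda>u. h u / (u - 0)) has_contour_integral (2 * of_real pi * \<i> * h 0)) (circlepath 0 1)"
    using assms by (intro Cauchy_integral_circlepath_simple) auto
  then have "((\<lambda>t. h (circlepath 0 1 t) / circlepath 0 1 t * vector_derivative (circlepath 0 1) (at t))
      has_integral 2 * of_real pi * \<i> * h 0) {0..1}"
    by (simp add: has_contour_integral)
  then have "((\<lambda>t. (2 * of_real pi * \<i>) * h (cis (2 * pi * t)))
      has_integral 2 * of_real pi * \<i> * h 0) {0..1}"
    by (rule has_integral_eq[rotated])
      (simp add: vector_derivative_circlepath, simp add: circlepath cis_conv_exp mult_ac)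
  from has_integral_mult_right[OF this, of "inverse (2 * of_real pi * \<i>)"] show ?thesis
    by (simp add: field_simps)
qed

text \<open>Cauchy's inequality for the slice in direction v, on the disc of radius
  \<open>r / norm v\<close> that the slice maps into the ball. Being linear in
  \<open>norm v\<close>, the bound is an operator norm estimate, the form in which sequences of
  derivatives are compared below.\<close>

lemma holomorphic_Cn_derivative_bound:
  fixes z :: "complex ^ 'n"
  assumes hol: "holomorphic_Cn f (cball z r)" and "0 < r"
    and B: "\<And>x. x \<in> cball z r \<Longrightarrow> cmod (f x) \<le> B"
    and f': "(f has_derivative f') (at z)" "\<And>c v. f' (c *s v) = c * f' v"
  shows "cmod (f' v) \<le> B / r * norm v"
proof (cases "v = 0")
  case True
  then have "0 *s v = v" by (simp add: vec_eq_iff)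
  then have "f' v = 0" using f'(2)[of 0 v] by simp
  then show ?thesis using True by simp
next
  case False
  define \<rho> where "\<rho> = r / norm v"
  have "\<rho> > 0" using False \<open>0 < r\<close> by (simp add: \<rho>_def)
  have mem: "z + \<zeta> *s v \<in> cball z r" if "\<zeta> \<in> cball 0 \<rho>" for \<zeta>
  proof -
    have "cmod \<zeta> * norm v \<le> \<rho> * norm v"
      using that by (intro mult_right_mono) auto
    then show ?thesis
      using False by (simp add: dist_norm norm_vector_smult \<rho>_def)
  qed
  have hol': "(\<lambda>\<zeta>. f (z + \<zeta> *s v)) holomorphic_on cball 0 \<rho>"
    using holomorphic_Cn_slice[OF hol mem] by blast
  have "cmod ((deriv ^^ 1) (\<lambda>\<zeta>. f (z + \<zeta> *s v)) 0) \<le> fact 1 * B / \<rho> ^ 1"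
  proof (rule Cauchy_inequality)
    show "(\<lambda>\<zeta>. f (z + \<zeta> *s v)) holomorphic_on ball 0 \<rho>"
      using hol' by (rule holomorphic_on_subset) auto
    show "continuous_on (cball 0 \<rho>) (\<lambda>\<zeta>. f (z + \<zeta> *s v))"
      using hol' by (rule holomorphic_on_imp_continuous_on)
    show "cmod (f (z + \<zeta> *s v)) \<le> B" if "cmod (0 - \<zeta>) = \<rho>" for \<zeta>
      using that by (intro B mem) simp
  qed fact
  moreover have "((\<lambda>\<zeta>. f (z + \<zeta> *s v)) has_field_derivative f' v) (at 0)"
    using f' by (intro holomorphic_Cn_slice_deriv) auto
  ultimately show ?thesis
    by (simp add: DERIV_imp_deriv \<rho>_def)
qed

text \<open>Weierstrass' theorem. Cauchy estimates make the derivatives a uniformly Cauchy sequence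
  on a smaller ball, so the limit is differentiable there, and complex homogeneity survives the
  limit. As \<open>holomorphic_Cn\<close> is a pointwise condition, the conclusion at the centre
  alone can be assembled over all of \<Omega>.\<close>

lemma holomorphic_Cn_uniform_limit:
  fixes z :: "complex ^ 'n"
  assumes hol: "\<And>n. holomorphic_Cn (F n) (cball z r)" and "0 < r"
    and lim: "uniform_limit (cball z r) F g sequentially"
  shows "holomorphic_Cn g {z}"
proof -
  have "\<exists>f'. \<forall>x\<in>cball z r. (F n has_derivative f' x) (at x) \<and> (\<forall>c v. f' x (c *s v) = c * f' x v)" for n
    using hol[of n] unfolding holomorphic_Cn_def by metis
  then obtain F' where F': "\<And>n x. x \<in> cball z r \<Longrightarrow> (F n has_derivative F' n x) (at x)"
    and hom: "\<And>n x c v. x \<in> cball z r \<Longrightarrow> F' n x (c *s v) = c * F' n x v"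
    by metis
  \<comment> \<open>Every point of the half ball is the centre of a ball of radius r/2 inside the
    original one, so one constant serves all Cauchy estimates.\<close>
  define S where "S = ball z (r / 2)"
  have S: "cball x (r / 2) \<subseteq> cball z r" "x \<in> cball z r" if "x \<in> S" for x
  proof
    fix y assume "y \<in> cball x (r / 2)"
    then show "y \<in> cball z r"
      using that dist_triangle[of z y x] by (auto simp: S_def)
  next
    show "x \<in> cball z r"
      using that zero_le_dist[of z x] unfolding S_def mem_ball mem_cball by linarith
  qed
  have Cauchy: "\<exists>N. \<forall>m\<ge>N. \<forall>n\<ge>N. \<forall>x\<in>S. \<forall>v. cmod (F' m x v - F' n x v) \<le> e * norm v"
    if "e > 0" for e
  proof -
    \<comment> \<open>Two errors of this size add up to e*r/2, and the Cauchy estimate divides by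
      r/2.\<close>
    have "e * r / 4 > 0" using that \<open>0 < r\<close> by simp
    then obtain N where N: "\<And>n x. n \<ge> N \<Longrightarrow> x \<in> cball z r \<Longrightarrow> cmod (F n x - g x) < e * r / 4"
      using lim unfolding uniform_limit_iff eventually_sequentially by (metis dist_norm)
    have "cmod (F' m x v - F' n x v) \<le> e * norm v" if "m \<ge> N" "n \<ge> N" "x \<in> S" for m n x v
    proof -
      have "cmod (F' m x v - F' n x v) \<le> (e * r / 2) / (r / 2) * norm v"
      proof (rule holomorphic_Cn_derivative_bound)
        have "holomorphic_Cn (\<lambda>x. F m x + (- 1) * F n x) (cball z r)"
          by (intro holomorphic_Cn_add holomorphic_Cn_cmult hol)
        then show "holomorphic_Cn (\<lambda>x. F m x - F n x) (cball x (r / 2))"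
          using S[OF \<open>x \<in> S\<close>] by (auto intro: holomorphic_Cn_subset)
        fix y assume "y \<in> cball x (r / 2)"
        then have "y \<in> cball z r" using S[OF \<open>x \<in> S\<close>] by blast
        then have "cmod (F m y - g y) < e * r / 4" "cmod (F n y - g y) < e * r / 4"
          using N that by auto
        then show "cmod (F m y - F n y) \<le> e * r / 2"
          using norm_triangle_ineq4[of "F m y - g y" "F n y - g y"] by simp
      next
        show "((\<lambda>x. F m x - F n x) has_derivative (\<lambda>v. F' m x v - F' n x v)) (at x)"
          using S[OF \<open>x \<in> S\<close>] by (intro has_derivative_diff F')
      qed (use \<open>0 < r\<close> S[OF \<open>x \<in> S\<close>] in \<open>auto simp: hom algebra_simps\<close>)
      then show ?thesis using \<open>0 < r\<close> by simp
    qed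
    then show ?thesis by blast
  qed
  have "\<exists>l. (\<lambda>n. F' n x v) \<longlonglongrightarrow> l" if "x \<in> S" for x v
  proof -
    have "Cauchy (\<lambda>n. F' n x v)"
    proof (rule metric_CauchyI)
      fix e :: real assume "e > 0"
      \<comment> \<open>The added 1 covers v = 0 and makes the resulting inequality strict.\<close>
      define d where "d = e / (norm v + 1)"
      have pos: "norm v + 1 > 0" by (simp add: add_nonneg_pos)
      then have "d > 0" using \<open>e > 0\<close> by (simp add: d_def)
      then obtain N where N: "\<And>m n. m \<ge> N \<Longrightarrow> n \<ge> N \<Longrightarrow> cmod (F' m x v - F' n x v) \<le> d * norm v"
        using Cauchy[of d] \<open>x \<in> S\<close> by blast
      have "d * norm v < e"
        unfolding d_def times_divide_eq_left pos_divide_less_eq[OF pos] using \<open>e > 0\<close> by (simp add: distrib_left)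
      then show "\<exists>M. \<forall>m\<ge>M. \<forall>n\<ge>M. dist (F' m x v) (F' n x v) < e"
        using N by (metis dist_norm le_less_trans)
    qed
    then show ?thesis
      by (simp add: Cauchy_convergent_iff convergent_def)
  qed
  then obtain G where G: "\<And>x v. x \<in> S \<Longrightarrow> (\<lambda>n. F' n x v) \<longlonglongrightarrow> G x v"
    by metis
  have "z \<in> S" "open S" "convex S" using \<open>0 < r\<close> by (auto simp: S_def)
  have pt: "(\<lambda>n. F n x) \<longlonglongrightarrow> g x" if "x \<in> S" for x
    using tendsto_uniform_limitI[OF lim] S[OF that] by blast
  have "\<exists>g2. \<forall>x\<in>S. (\<lambda>n. F n x) \<longlonglongrightarrow> g2 x \<and> (g2 has_derivative G x) (at x within S)"
  proof (rule has_derivative_sequence[where f = F and f' = F' and g' = G, OF \<open>convex S\<close> _ _ \<open>z \<in> S\<close> pt[OF \<open>z \<in> S\<close>]])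
    show "(F n has_derivative F' n x) (at x within S)" if "x \<in> S" for n x
      using F' S[OF that] has_derivative_at_withinI by blast
    fix e :: real assume "e > 0"
    then obtain N where N: "\<And>m n x v. m \<ge> N \<Longrightarrow> n \<ge> N \<Longrightarrow> x \<in> S \<Longrightarrow> cmod (F' m x v - F' n x v) \<le> e * norm v"
      using Cauchy by meson
    have "cmod (F' n x v - G x v) \<le> e * norm v" if "n \<ge> N" "x \<in> S" for n x v
    proof (rule tendsto_upperbound)
      show "(\<lambda>m. cmod (F' n x v - F' m x v)) \<longlonglongrightarrow> cmod (F' n x v - G x v)"
        by (intro tendsto_intros G that)
      show "\<forall>\<^sub>F m in sequentially. cmod (F' n x v - F' m x v) \<le> e * norm v"
        using N that unfolding eventually_sequentially by blast
    qed simp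
    then show "\<forall>\<^sub>F n in sequentially. \<forall>x\<in>S. \<forall>v. cmod (F' n x v - G x v) \<le> e * norm v"
      unfolding eventually_sequentially by blast
  qed
  then obtain g2 where g2: "\<And>x. x \<in> S \<Longrightarrow> (\<lambda>n. F n x) \<longlonglongrightarrow> g2 x"
    "\<And>x. x \<in> S \<Longrightarrow> (g2 has_derivative G x) (at x within S)" by blast
  have "(g2 has_derivative G z) (at z)"
    using g2(2)[OF \<open>z \<in> S\<close>] \<open>z \<in> S\<close> \<open>open S\<close> by (metis at_within_open)
  \<comment> \<open>The differentiation theorem supplies its own limit function; it coincides with g
    on the open set S only, which suffices for the derivative at z.\<close>
  moreover have "g2 x = g x" if "x \<in> S" for x
    using LIMSEQ_unique g2(1) pt that by blast
  ultimately have "(g has_derivative G z) (at z)"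
    using \<open>z \<in> S\<close> \<open>open S\<close> has_derivative_transform_within_open by blast
  moreover have "G z (c *s v) = c * G z v" for c v
  proof (rule LIMSEQ_unique[OF G[OF \<open>z \<in> S\<close>]])
    have "z \<in> cball z r" using \<open>0 < r\<close> by simp
    then show "(\<lambda>n. F' n z (c *s v)) \<longlonglongrightarrow> c * G z v"
      using tendsto_mult_left[OF G[OF \<open>z \<in> S\<close>, of v], of c] by (simp add: hom)
  qed
  ultimately show ?thesis
    unfolding holomorphic_Cn_def by blast
qed

section \<open>Zero sets\<close>

text \<open>Countability of the zeros of a nonconstant holomorphic function rests on exhausting its
  domain by countably many compact sets; this supplies the exhaustion.\<close>

lemma open_imp_fsigma:
  fixes S :: "'a::euclidean_space set"
  assumes "open S"
  shows "fsigma S"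
proof (rule open_Union_compact_subsets[OF assms])
  fix C :: "nat \<Rightarrow> 'a set"
  assume "\<And>n. compact (C n)" "\<Union>(range C) = S"
  then show "fsigma S"
    unfolding fsigma_Union_compact by (intro exI[of _ C]) auto
qed

text \<open>Every real ray from a point \<open>q\<close> with \<open>f q \<noteq> 0\<close> meets the zero set in a countable set, so a
  Fubini argument over the dilations centred at \<open>q\<close> shows that the zero set is null.\<close>

lemma negligible_zero_set_ball:
  fixes p :: "complex ^ 'n"
  assumes f: "holomorphic_Cn f (ball p r)" and q: "q \<in> ball p r" "f q \<noteq> 0"
  shows "negligible {z \<in> ball p r. f z = 0}"
proof -
  let ?Z = "{z \<in> ball p r. f z = 0}"
  obtain T where "closed T" "?Z = ball p r \<inter> T"
    using continuous_closedin_preimage_constant[OF holomorphic_Cn_imp_continuous_on[OF f]]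
    unfolding closedin_closed by blast
  then have Z[measurable]: "?Z \<in> sets borel" by auto
  \<comment> \<open>The zero set is translated so that q becomes the origin and its rays become
    orbits of dilations.\<close>
  define E where "E = {x. q + x \<in> ?Z}"
  have E[measurable]: "E \<in> sets borel"
    unfolding E_def by measurable
  \<comment> \<open>A real ray lies in the complex line through q in direction x. That line meets
    the ball in an open convex parameter set, on which the slice of f is holomorphic and nonzero at
    parameter 0; hence its zeros are countable.\<close>
  have count: "countable {t::real. t *\<^sub>R x \<in> E}" for x
  proof -
    define S where "S = (\<lambda>\<zeta>. \<zeta> *s x) -` ball (p - q) r"
    have memS: "\<zeta> \<in> S \<longleftrightarrow> q + \<zeta> *s x \<in> ball p r" for \<zeta>
      by (simp add: S_def dist_norm algebra_simps)
    have "open S"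
      unfolding S_def using linear_continuous_on[OF vector_smult_bounded_linear]
      by (intro open_vimage) auto
    have "convex S"
      unfolding S_def
      by (intro convex_linear_vimage bounded_linear.linear vector_smult_bounded_linear convex_ball)
    let ?h = "\<lambda>\<zeta>. f (q + \<zeta> *s x)"
    have hol: "?h holomorphic_on S"
      using memS by (intro holomorphic_Cn_slice[OF f]) auto
    have "0 \<in> S" using q by (simp add: memS)
    have "countable {\<zeta> \<in> S. ?h \<zeta> = 0}"
    proof (cases "?h constant_on S")
      case True
      then have "{\<zeta> \<in> S. ?h \<zeta> = 0} = {}"
        using \<open>0 \<in> S\<close> q(2) unfolding constant_on_def by fastforce
      then show ?thesis by (simp only: countable_empty)
    next
      case False
      then show ?thesis
        using holomorphic_countable_zeros[OF hol \<open>open S\<close> convex_connected[OF \<open>convex S\<close>]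
            open_imp_fsigma[OF \<open>open S\<close>]] by blast
    qed
    moreover have "of_real ` {t::real. t *\<^sub>R x \<in> E} \<subseteq> {\<zeta> \<in> S. ?h \<zeta> = 0}"
      by (auto simp: E_def memS vector_smult_scaleR)
    ultimately have "countable (complex_of_real ` {t::real. t *\<^sub>R x \<in> E})"
      by (rule countable_subset[rotated])
    then show ?thesis
      by (subst (asm) countable_image_inj_eq) (auto simp: inj_on_def)
  qed
  have dilate: "emeasure lborel E = ennreal (\<bar>t\<bar> ^ DIM(complex ^ 'n)) * (\<integral>\<^sup>+x. indicator E (t *\<^sub>R x) \<partial>lborel)"
    if "t \<noteq> 0" for t
    using that nn_integral_distr[of "\<lambda>x. t *\<^sub>R x" lborel borel "indicator E"]
    by (subst lborel_affine[OF that, of 0]) (simp add: emeasure_density_const)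
  have "(\<integral>\<^sup>+t. (\<integral>\<^sup>+x. indicator {1..2::real} t * indicator E (t *\<^sub>R x) \<partial>lborel) \<partial>lborel)
      = (\<integral>\<^sup>+x. (\<integral>\<^sup>+t. indicator {1..2} t * indicator E (t *\<^sub>R x) \<partial>lborel) \<partial>lborel)"
    by (rule lborel_pair.Fubini') measurable
  also have "\<dots> = (\<integral>\<^sup>+(x::complex ^ 'n). 0 \<partial>lborel)"
  proof (rule nn_integral_cong)
    fix x :: "complex ^ 'n"
    have "AE t in lborel. t \<notin> {t::real. t *\<^sub>R x \<in> E}"
      using emeasure_lborel_countable[OF count] by (intro AE_not_in null_setsI) (auto simp: count)
    then show "(\<integral>\<^sup>+t. indicator {1..2} t * indicator E (t *\<^sub>R x) \<partial>lborel) = 0"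
      by (subst nn_integral_0_iff_AE) (auto elim!: eventually_mono simp: indicator_def)
  qed
  finally have "(\<integral>\<^sup>+t. (\<integral>\<^sup>+x. indicator {1..2::real} t * indicator E (t *\<^sub>R x) \<partial>lborel) \<partial>lborel) = 0"
    by simp
  then have "AE t in lborel. (\<integral>\<^sup>+x. indicator {1..2::real} t * indicator E (t *\<^sub>R x) \<partial>lborel) = 0"
    by (subst (asm) nn_integral_0_iff_AE) auto
  \<comment> \<open>No t in [1,2] is 0, so by \<open>dilate\<close> a vanishing inner integral for a
    single such t gives |E| = 0. The positive length of the interval provides such a t.\<close>
  then have AE: "AE t in lborel. t \<in> {1..2::real} \<longrightarrow> emeasure lborel E = 0"
  proof (rule eventually_mono, intro impI)
    fix t :: real
    assume "(\<integral>\<^sup>+x. indicator {1..2} t * indicator E (t *\<^sub>R x) \<partial>lborel) = 0" "t \<in> {1..2}"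
    then show "emeasure lborel E = 0" using dilate[of t] by simp
  qed
  have "emeasure lborel E = 0"
  proof (rule ccontr)
    assume "emeasure lborel E \<noteq> 0"
    with AE have "AE t in lborel. t \<notin> {1..2::real}" by (auto elim!: eventually_mono)
    then have "emeasure lborel {1..2::real} = 0"
      by (subst (asm) AE_iff_measurable[of "{1..2}"]) auto
    then show False by simp
  qed
  then have "negligible E"
    by (simp add: negligible_iff_emeasure0)
  then have "negligible ((+) q ` E)"
    by (rule negligible_translation)
  moreover have "?Z \<subseteq> (+) q ` E"
    by (auto simp: E_def image_iff intro!: exI[of _ "_ - q"])
  ultimately show ?thesis
    by (rule negligible_subset)
qed

text \<open>A connectedness argument. Let A be the points near which f vanishes identically and B
  those near which its zero set is null. Both are open, the dichotomy on balls makes them cover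
  \<Omega>, and they are disjoint because a ball is not null. Since z0 is outside A, all of \<Omega>
  lies in B, and a locally null set is null.\<close>

lemma negligible_zero_set:
  fixes \<Omega> :: "(complex ^ 'n) set"
  assumes \<Omega>: "open \<Omega>" "connected \<Omega>" and f: "holomorphic_Cn f \<Omega>" and nz: "z0 \<in> \<Omega>" "f z0 \<noteq> 0"
  shows "negligible {z \<in> \<Omega>. f z = 0}"
proof -
  have dichotomy: "(\<forall>w\<in>ball p r. f w = 0) \<or> negligible {z \<in> ball p r. f z = 0}"
    if "ball p r \<subseteq> \<Omega>" for p r
    using negligible_zero_set_ball holomorphic_Cn_subset[OF f that] by blast
  have balls: "\<exists>r>0. ball p r \<subseteq> \<Omega>" if "p \<in> \<Omega>" for p
    using \<Omega>(1) that open_contains_ball by blast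
  define A where "A = {p. \<exists>r>0. ball p r \<subseteq> \<Omega> \<and> (\<forall>w\<in>ball p r. f w = 0)}"
  define B where "B = {p. \<exists>r>0. ball p r \<subseteq> \<Omega> \<and> negligible {z \<in> ball p r. f z = 0}}"
  have sub: "\<exists>e>0. ball y e \<subseteq> ball p r" if "y \<in> ball p r" for y p :: "complex ^ 'n" and r
    using that open_ball open_contains_ball by blast
  have "open A"
    unfolding open_contains_ball
  proof
    fix p assume "p \<in> A"
    then obtain r where r: "r > 0" "ball p r \<subseteq> \<Omega>" "\<forall>w\<in>ball p r. f w = 0" by (auto simp: A_def)
    have "ball p r \<subseteq> A"
      using r sub[of _ p r] unfolding A_def by blast
    then show "\<exists>e>0. ball p e \<subseteq> A" using r by blast
  qed
  moreover have "open B"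
    unfolding open_contains_ball
  proof
    fix p assume "p \<in> B"
    then obtain r where r: "r > 0" "ball p r \<subseteq> \<Omega>" "negligible {z \<in> ball p r. f z = 0}" by (auto simp: B_def)
    have "y \<in> B" if y: "y \<in> ball p r" for y
    proof -
      obtain e where e: "e > 0" "ball y e \<subseteq> ball p r" using sub[OF y] by blast
      then have "negligible {z \<in> ball y e. f z = 0}"
        by (intro negligible_subset[OF r(3)]) blast
      then show ?thesis using e r by (auto simp: B_def)
    qed
    then show "\<exists>e>0. ball p e \<subseteq> B" using r by blast
  qed
  moreover have "\<Omega> \<subseteq> A \<union> B"
    using dichotomy balls unfolding A_def B_def by blast
  moreover have "A \<inter> B \<inter> \<Omega> = {}"
  proof -
    have False if "p \<in> A" "p \<in> B" for p
    proof -
      obtain r where r: "r > 0" "\<forall>w\<in>ball p r. f w = 0" using \<open>p \<in> A\<close> by (auto simp: A_def)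
      obtain e where e: "e > 0" "negligible {z \<in> ball p e. f z = 0}" using \<open>p \<in> B\<close> by (auto simp: B_def)
      have "negligible (ball p (min r e))"
        using r by (intro negligible_subset[OF e(2)]) auto
      then show False
        using r(1) e(1) open_not_negligible[of "ball p (min r e)"] by simp
    qed
    then show ?thesis by blast
  qed
  moreover have "z0 \<notin> A"
    using nz(2) by (auto simp: A_def)
  ultimately have "A \<inter> \<Omega> = {}"
    using \<Omega>(2) nz(1) unfolding connected_def by blast
  then have "\<Omega> \<subseteq> B" using \<open>\<Omega> \<subseteq> A \<union> B\<close> by blast
  show ?thesis
    unfolding locally_negligible_alt[of "{z \<in> \<Omega>. f z = 0}"]
  proof
    fix p assume p: "p \<in> {z \<in> \<Omega>. f z = 0}"
    then obtain r where r: "r > 0" "ball p r \<subseteq> \<Omega>" "negligible {z \<in> ball p r. f z = 0}"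
      using \<open>\<Omega> \<subseteq> B\<close> by (auto simp: B_def)
    have eq: "{z \<in> ball p r. f z = 0} = {z \<in> \<Omega>. f z = 0} \<inter> ball p r"
      using r by auto
    have "openin (top_of_set {z \<in> \<Omega>. f z = 0}) {z \<in> ball p r. f z = 0}"
      unfolding eq by (intro openin_open_Int open_ball)
    moreover have "p \<in> {z \<in> ball p r. f z = 0}" using p r(1) by simp
    ultimately show "\<exists>U. openin (top_of_set {z \<in> \<Omega>. f z = 0}) U \<and> p \<in> U \<and> negligible U"
      using r(3) by blast
  qed
qed

section \<open>The Bergman space\<close>

locale bergman_space =
  fixes \<Omega> :: "(complex ^ 'n) set"
  assumes open_domain: "open \<Omega>"
begin

text \<open>Fubini and the invariance under translations and rotations are used for
  \<open>lborel\<close>. Extension by 0 removes the restriction to \<Omega>, Borel measurability the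
  completion.\<close>

lemma lebesgue_on_eq_lborel:
  fixes h :: "complex ^ 'n \<Rightarrow> 'b::{banach, second_countable_topology}"
  assumes h: "h \<in> borel_measurable borel" and 0: "\<And>z. z \<notin> \<Omega> \<Longrightarrow> h z = 0"
  shows "integrable (lebesgue_on \<Omega>) h \<longleftrightarrow> integrable lborel h"
    and "integral\<^sup>L (lebesgue_on \<Omega>) h = integral\<^sup>L lborel h"
proof -
  have "(\<lambda>z. indicator \<Omega> z *\<^sub>R h z) = h"
    using 0 by (auto simp: fun_eq_iff indicator_def)
  moreover have "\<Omega> \<inter> space lebesgue \<in> sets lebesgue"
    using open_domain by simp
  ultimately show "integrable (lebesgue_on \<Omega>) h \<longleftrightarrow> integrable lborel h"
    and "integral\<^sup>L (lebesgue_on \<Omega>) h = integral\<^sup>L lborel h"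
    using h by (simp_all add: integrable_restrict_space integral_restrict_space
        integrable_completion integral_completion)
qed

lemma holomorphic_Cn_borel_measurable:
  assumes "holomorphic_Cn f \<Omega>" and 0: "\<And>z. z \<notin> \<Omega> \<Longrightarrow> f z = 0"
  shows "f \<in> borel_measurable borel"
proof -
  have "(\<lambda>z. indicator \<Omega> z *\<^sub>R f z) = f"
    using 0 by (auto simp: fun_eq_iff indicator_def)
  then show ?thesis
    using borel_measurable_continuous_on_indicator[OF _ holomorphic_Cn_imp_continuous_on[OF assms(1)]]
      open_domain by simp
qed

lemma A2_iff:
  "f \<in> A2 \<Omega> \<longleftrightarrow> holomorphic_Cn f \<Omega> \<and> integrable lborel (\<lambda>z. (cmod (f z))\<^sup>2) \<and> (\<forall>z. z \<notin> \<Omega> \<longrightarrow> f z = 0)"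
proof -
  have "integrable (lebesgue_on \<Omega>) (\<lambda>z. (cmod (f z))\<^sup>2) \<longleftrightarrow> integrable lborel (\<lambda>z. (cmod (f z))\<^sup>2)"
    if "holomorphic_Cn f \<Omega>" "\<forall>z. z \<notin> \<Omega> \<longrightarrow> f z = 0"
  proof -
    have [measurable]: "f \<in> borel_measurable borel"
      using that by (intro holomorphic_Cn_borel_measurable) auto
    show ?thesis
      using that by (intro lebesgue_on_eq_lborel) auto
  qed
  then show ?thesis
    unfolding A2_def by blast
qed

lemma A2_D:
  assumes "f \<in> A2 \<Omega>"
  shows "holomorphic_Cn f \<Omega>" "integrable lborel (\<lambda>z. (cmod (f z))\<^sup>2)" "\<And>z. z \<notin> \<Omega> \<Longrightarrow> f z = 0"
    "f \<in> borel_measurable borel" "continuous_on \<Omega> f"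
  using assms holomorphic_Cn_borel_measurable holomorphic_Cn_imp_continuous_on unfolding A2_iff by auto

lemma norm_square_eq:
  assumes "f \<in> A2 \<Omega>"
  shows "(L2_norm_on \<Omega> f)\<^sup>2 = (\<integral>z. (cmod (f z))\<^sup>2 \<partial>lborel)"
proof -
  have [measurable]: "f \<in> borel_measurable borel" using A2_D(4)[OF assms] .
  have "(L2_norm_on \<Omega> f)\<^sup>2 = (\<integral>z. (cmod (f z))\<^sup>2 \<partial>lebesgue_on \<Omega>)"
    by (simp add: L2_norm_on_def)
  also have "\<dots> = (\<integral>z. (cmod (f z))\<^sup>2 \<partial>lborel)"
    using A2_D(3)[OF assms] by (intro lebesgue_on_eq_lborel) auto
  finally show ?thesis .
qed

lemma L2_norm_nonneg [simp]: "0 \<le> L2_norm_on \<Omega> f"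
  by (simp add: L2_norm_on_def)

section \<open>The inner product on the Bergman space\<close>

lemma inner_eq:
  assumes "f \<in> A2 \<Omega>" "g \<in> A2 \<Omega>"
  shows "A2_inner \<Omega> f g = (\<integral>z. f z * cnj (g z) \<partial>lborel)"
    and inner_integrable: "integrable lborel (\<lambda>z. f z * cnj (g z))"
proof -
  have [measurable]: "f \<in> borel_measurable borel" "g \<in> borel_measurable borel"
    using assms by (auto intro: A2_D)
  have [measurable]: "cnj \<in> borel_measurable borel"
    by (intro borel_measurable_continuous_onI continuous_intros)
  show "A2_inner \<Omega> f g = (\<integral>z. f z * cnj (g z) \<partial>lborel)"
    unfolding A2_inner_def
    using A2_D(3)[OF assms(1)] by (intro lebesgue_on_eq_lborel) auto
  show "integrable lborel (\<lambda>z. f z * cnj (g z))"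
  proof (rule Bochner_Integration.integrable_bound)
    show "integrable lborel (\<lambda>z. (cmod (f z))\<^sup>2 + (cmod (g z))\<^sup>2)"
      using assms by (intro Bochner_Integration.integrable_add A2_D)
    have "cmod (f z * cnj (g z)) \<le> (cmod (f z))\<^sup>2 + (cmod (g z))\<^sup>2" for z
      using sum_squares_bound[of "cmod (f z)" "cmod (g z)"]
        mult_nonneg_nonneg[OF norm_ge_zero[of "f z"] norm_ge_zero[of "g z"]]
      unfolding norm_mult complex_mod_cnj by linarith
    then show "AE z in lborel. cmod (f z * cnj (g z)) \<le> norm ((cmod (f z))\<^sup>2 + (cmod (g z))\<^sup>2)"
      by simp
  qed measurable
qed

lemma A2_cmult: "f \<in> A2 \<Omega> \<Longrightarrow> (\<lambda>z. c * f z) \<in> A2 \<Omega>"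
  unfolding A2_iff
  by (auto simp: norm_mult power_mult_distrib intro: holomorphic_Cn_cmult)

lemma A2_add:
  assumes "f \<in> A2 \<Omega>" "g \<in> A2 \<Omega>"
  shows "(\<lambda>z. f z + g z) \<in> A2 \<Omega>"
  unfolding A2_iff
proof (intro conjI allI impI)
  have [measurable]: "f \<in> borel_measurable borel" "g \<in> borel_measurable borel"
    using assms by (auto intro: A2_D)
  show "integrable lborel (\<lambda>z. (cmod (f z + g z))\<^sup>2)"
  proof (rule Bochner_Integration.integrable_bound)
    show "integrable lborel (\<lambda>z. 2 * (cmod (f z))\<^sup>2 + 2 * (cmod (g z))\<^sup>2)"
      using assms by (intro Bochner_Integration.integrable_add integrable_mult_right A2_D)
    have "(cmod (f z + g z))\<^sup>2 \<le> 2 * (cmod (f z))\<^sup>2 + 2 * (cmod (g z))\<^sup>2" for z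
      using power_mono[OF norm_triangle_ineq[of "f z" "g z"] norm_ge_zero, of 2]
        sum_squares_bound[of "cmod (f z)" "cmod (g z)"] by (simp add: power2_sum)
    then show "AE z in lborel. norm ((cmod (f z + g z))\<^sup>2)
        \<le> norm (2 * (cmod (f z))\<^sup>2 + 2 * (cmod (g z))\<^sup>2)"
      by simp
  qed measurable
qed (use A2_D(1,3)[OF assms(1)] A2_D(1,3)[OF assms(2)] in \<open>auto intro: holomorphic_Cn_add\<close>)

lemma A2_zero: "(\<lambda>z. 0) \<in> A2 \<Omega>"
proof -
  have "holomorphic_Cn (\<lambda>z. 0) \<Omega>"
    unfolding holomorphic_Cn_def by (intro ballI exI[of _ "\<lambda>v. 0"]) auto
  then show ?thesis unfolding A2_iff by simp
qed

lemma A2_diff: "f \<in> A2 \<Omega> \<Longrightarrow> g \<in> A2 \<Omega> \<Longrightarrow> (\<lambda>z. f z - g z) \<in> A2 \<Omega>"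
  using A2_add[of f "\<lambda>z. (- 1) * g z"] A2_cmult[of g "- 1"] by simp

lemma A2_sum: "(\<And>j. j \<in> J \<Longrightarrow> u j \<in> A2 \<Omega>) \<Longrightarrow> (\<lambda>z. \<Sum>j\<in>J. u j z) \<in> A2 \<Omega>"
  by (induction J rule: infinite_finite_induct) (auto intro: A2_zero A2_add)

lemma inner_add_left:
  "f \<in> A2 \<Omega> \<Longrightarrow> g \<in> A2 \<Omega> \<Longrightarrow> h \<in> A2 \<Omega> \<Longrightarrow>
    A2_inner \<Omega> (\<lambda>z. f z + g z) h = A2_inner \<Omega> f h + A2_inner \<Omega> g h"
  by (simp add: inner_eq A2_add inner_integrable distrib_right)

lemma inner_cmult_left:
  "f \<in> A2 \<Omega> \<Longrightarrow> h \<in> A2 \<Omega> \<Longrightarrow> A2_inner \<Omega> (\<lambda>z. c * f z) h = c * A2_inner \<Omega> f h"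
  by (simp add: inner_eq A2_cmult mult.assoc)

lemma inner_commute:
  "f \<in> A2 \<Omega> \<Longrightarrow> g \<in> A2 \<Omega> \<Longrightarrow> A2_inner \<Omega> g f = cnj (A2_inner \<Omega> f g)"
  using Bochner_Integration.integral_cnj[of lborel "\<lambda>z. f z * cnj (g z)"] by (simp add: inner_eq mult.commute)

lemma inner_add_right:
  assumes "f \<in> A2 \<Omega>" "g \<in> A2 \<Omega>" "h \<in> A2 \<Omega>"
  shows "A2_inner \<Omega> h (\<lambda>z. f z + g z) = A2_inner \<Omega> h f + A2_inner \<Omega> h g"
  using inner_commute[OF _ assms(3)] inner_add_left[OF assms] assms A2_add[OF assms(1,2)] by simp

lemma inner_cmult_right:
  assumes "f \<in> A2 \<Omega>" "h \<in> A2 \<Omega>"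
  shows "A2_inner \<Omega> h (\<lambda>z. c * f z) = cnj c * A2_inner \<Omega> h f"
  using inner_commute[OF _ assms(2)] inner_cmult_left[OF assms] assms A2_cmult[OF assms(1)] by simp

lemma inner_sum_left:
  assumes "\<And>j. j \<in> J \<Longrightarrow> u j \<in> A2 \<Omega>" "h \<in> A2 \<Omega>"
  shows "A2_inner \<Omega> (\<lambda>z. \<Sum>j\<in>J. u j z) h = (\<Sum>j\<in>J. A2_inner \<Omega> (u j) h)"
  using assms
proof (induction J rule: infinite_finite_induct)
  case (insert j J)
  then show ?case by (simp add: inner_add_left A2_sum)
qed (simp_all add: A2_inner_def)

lemma inner_diff_left:
  assumes "f \<in> A2 \<Omega>" "g \<in> A2 \<Omega>" "h \<in> A2 \<Omega>"
  shows "A2_inner \<Omega> (\<lambda>z. f z - g z) h = A2_inner \<Omega> f h - A2_inner \<Omega> g h"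
  using inner_add_left[OF assms(1) A2_cmult[OF assms(2), of "- 1"] assms(3)]
    inner_cmult_left[OF assms(2,3), of "- 1"] by simp

lemma inner_self: "f \<in> A2 \<Omega> \<Longrightarrow> A2_inner \<Omega> f f = of_real ((L2_norm_on \<Omega> f)\<^sup>2)"
  by (simp add: inner_eq norm_square_eq complex_norm_square[symmetric] integral_complex_of_real[symmetric]
      del: of_real_power integral_complex_of_real)

lemma norm_cmult: "L2_norm_on \<Omega> (\<lambda>z. c * f z) = cmod c * L2_norm_on \<Omega> f"
  by (simp add: L2_norm_on_def norm_mult power_mult_distrib real_sqrt_mult)

text \<open>The mean value property is applied to the square of f because the modulus of that square
  is already the integrand of the norm; no convexity inequality intervenes. The mean is written as a
  nonnegative integral in order to enter Fubini.\<close>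

lemma mean_value_square_bound:
  assumes f: "holomorphic_Cn f \<Omega>" and z: "cball z r \<subseteq> \<Omega>" and w: "norm w < r"
    and [measurable]: "f \<in> borel_measurable borel"
  shows "ennreal ((cmod (f z))\<^sup>2)
    \<le> (\<integral>\<^sup>+t. ennreal ((cmod (f (z + cis (2 * pi * t) *s w)))\<^sup>2) * indicator {0..1} t \<partial>lborel)"
proof -
  define h where "h = (\<lambda>\<zeta>. (f (z + \<zeta> *s w))\<^sup>2)"
  have mem: "z + \<zeta> *s w \<in> \<Omega>" if "\<zeta> \<in> cball 0 1" for \<zeta>
  proof -
    have "cmod \<zeta> * norm w \<le> 1 * norm w"
      using that by (intro mult_right_mono) auto
    then show ?thesis
      using w z by (auto simp: dist_norm norm_vector_smult)
  qed
  have "h holomorphic_on cball 0 1"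
    unfolding h_def by (intro holomorphic_on_power holomorphic_Cn_slice[OF f mem])
  then have mv: "((\<lambda>t. h (cis (2 * pi * t))) has_integral h 0) {0..1}"
    and cont: "continuous_on (cball 0 1) h"
    by (auto intro: circle_mean_value holomorphic_on_imp_continuous_on)
  have "continuous_on {0..1} (\<lambda>t. cmod (h (cis (2 * pi * t))))"
    by (intro continuous_intros continuous_on_compose2[OF cont]) auto
  then have int: "(\<lambda>t. cmod (h (cis (2 * pi * t)))) integrable_on {0..1}"
    by (rule integrable_continuous_real)
  have "(cmod (f z))\<^sup>2 = cmod (h 0)"
    by (simp add: h_def norm_power)
  also have "h 0 = integral {0..1} (\<lambda>t. h (cis (2 * pi * t)))"
    using mv by (simp add: integral_unique)
  also have "cmod \<dots> \<le> integral {0..1} (\<lambda>t. cmod (h (cis (2 * pi * t))))"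
    using mv int by (intro integral_norm_bound_integral) (auto simp: has_integral_integrable)
  finally have "ennreal ((cmod (f z))\<^sup>2) \<le> ennreal (integral {0..1} (\<lambda>t. cmod (h (cis (2 * pi * t)))))"
    by (rule ennreal_leI)
  also have "\<dots> = (\<integral>\<^sup>+t. ennreal (cmod (h (cis (2 * pi * t)))) * indicator {0..1} t \<partial>lborel)"
    using int by (intro nn_integral_has_integral_lebesgue'[symmetric]) (auto simp: integrable_integral)
  finally show ?thesis by (simp add: h_def norm_power)
qed

text \<open>Averaging the one-variable mean value inequality for \<open>f\<^sup>2\<close> over all complex lines through \<open>z\<close>;
  the circle action preserves Lebesgue measure.\<close>

lemma point_evaluation_bound:
  assumes fA: "f \<in> A2 \<Omega>" and z: "cball z r \<subseteq> \<Omega>"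
  shows "(cmod (f z))\<^sup>2 * measure lborel (ball (0::complex ^ 'n) r) \<le> (L2_norm_on \<Omega> f)\<^sup>2"
proof -
  have f[measurable]: "f \<in> borel_measurable borel" using A2_D(4)[OF fA] .
  let ?B = "ball (0::complex ^ 'n) r"
  have [measurable]: "?B \<in> sets borel" by simp
  \<comment> \<open>Joint measurability of the circle action in (t, w), required for exchanging the
    average over the circle with the integral over the ball.\<close>
  have "continuous_on UNIV (\<lambda>p::real \<times> (complex ^ 'n). cis (2 * pi * fst p) *s snd p)"
    unfolding vector_scalar_mult_def by (intro continuous_intros)
  then have "(\<lambda>p::real \<times> (complex ^ 'n). cis (2 * pi * fst p) *s snd p) \<in> borel_measurable borel"
    by (rule borel_measurable_continuous_onI)
  then have rot[measurable]:
    "(\<lambda>p::real \<times> (complex ^ 'n). cis (2 * pi * fst p) *s snd p) \<in> borel_measurable (borel \<Otimes>\<^sub>M borel)"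
    by (simp add: borel_prod)
  define F where "F = (\<lambda>w. ennreal ((cmod (f w))\<^sup>2))"
  have [measurable]: "F \<in> borel_measurable borel" by (simp add: F_def)
  have "ennreal ((cmod (f z))\<^sup>2) * emeasure lborel ?B = (\<integral>\<^sup>+w. F z * indicator ?B w \<partial>lborel)"
    by (subst nn_integral_cmult) (auto simp: F_def)
  also have "\<dots> \<le> (\<integral>\<^sup>+w. (\<integral>\<^sup>+t. F (z + cis (2 * pi * t) *s w) * indicator {0..1} t * indicator ?B w \<partial>lborel) \<partial>lborel)"
  proof (rule nn_integral_mono)
    fix w :: "complex ^ 'n"
    show "F z * indicator ?B w
      \<le> (\<integral>\<^sup>+t. F (z + cis (2 * pi * t) *s w) * indicator {0..1} t * indicator ?B w \<partial>lborel)"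
      using mean_value_square_bound[OF A2_D(1)[OF fA] z _ f, of w]
      by (cases "w \<in> ?B") (auto simp: F_def)
  qed
  also have "\<dots> = (\<integral>\<^sup>+t. (\<integral>\<^sup>+w. F (z + cis (2 * pi * t) *s w) * indicator {0..1} t * indicator ?B w \<partial>lborel) \<partial>lborel)"
    by (rule lborel_pair.Fubini') measurable
  also have "\<dots> \<le> (\<integral>\<^sup>+t. (\<integral>\<^sup>+w. F w \<partial>lborel) * indicator {0..1::real} t \<partial>lborel)"
  proof (rule nn_integral_mono)
    fix t :: real
    have "(\<integral>\<^sup>+w. F (z + cis (2 * pi * t) *s w) * indicator {0..1} t * indicator ?B w \<partial>lborel)
      \<le> (\<integral>\<^sup>+w. F (z + cis (2 * pi * t) *s w) * indicator {0..1} t \<partial>lborel)"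
      by (intro nn_integral_mono) (auto simp: indicator_def)
    also have "\<dots> = (\<integral>\<^sup>+w. F (z + w) * indicator {0..1} t \<partial>lborel)"
      by (rule nn_integral_lborel_rotate[of "\<lambda>w. F (z + w) * indicator {0..1} t"]) auto
    also have "\<dots> = (\<integral>\<^sup>+w. F (z + w) \<partial>lborel) * indicator {0..1} t"
      by (rule nn_integral_multc) measurable
    also have "(\<integral>\<^sup>+w. F (z + w) \<partial>lborel) = (\<integral>\<^sup>+w. F w \<partial>lborel)"
      by (subst (2) lborel_distr_plus[of z, symmetric]) (simp add: nn_integral_distr)
    finally show "(\<integral>\<^sup>+w. F (z + cis (2 * pi * t) *s w) * indicator {0..1} t * indicator ?B w \<partial>lborel)
      \<le> (\<integral>\<^sup>+w. F w \<partial>lborel) * indicator {0..1} t" .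
  qed
  also have "\<dots> = (\<integral>\<^sup>+w. F w \<partial>lborel)"
    by (subst nn_integral_cmult) auto
  also have "\<dots> = ennreal ((L2_norm_on \<Omega> f)\<^sup>2)"
    unfolding F_def norm_square_eq[OF fA] using A2_D(2)[OF fA] by (intro nn_integral_eq_integral) auto
  finally have "ennreal ((cmod (f z))\<^sup>2) * emeasure lborel ?B \<le> ennreal ((L2_norm_on \<Omega> f)\<^sup>2)" .
  moreover have "emeasure lborel ?B = ennreal (measure lborel ?B)"
    using emeasure_lborel_ball_finite[of "0::complex ^ 'n" r] by (intro emeasure_eq_ennreal_measure) auto
  ultimately show ?thesis
    by (simp add: ennreal_mult[symmetric])
qed

text \<open>The evaluation bound yields vanishing at every point, not just almost everywhere, so the
  norm is definite on functions.\<close>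

lemma norm_eq_0D:
  assumes fA: "f \<in> A2 \<Omega>" and "L2_norm_on \<Omega> f = 0"
  shows "f = (\<lambda>z. 0)"
proof
  fix z
  show "f z = 0"
  proof (cases "z \<in> \<Omega>")
    case True
    then obtain r where r: "r > 0" "cball z r \<subseteq> \<Omega>"
      using open_domain open_contains_cball by blast
    have "(cmod (f z))\<^sup>2 * measure lborel (ball (0::complex ^ 'n) r) \<le> 0"
      using point_evaluation_bound[OF fA r(2)] assms(2) by simp
    moreover have "measure lborel (ball (0::complex ^ 'n) r) > 0"
      using r(1) by (rule content_ball_pos)
    ultimately show ?thesis
      by (simp add: mult_le_0_iff)
  qed (use A2_D(3)[OF fA] in blast)
qed

lemma norm_zero [simp]: "L2_norm_on \<Omega> (\<lambda>z. 0) = 0"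
  by (simp add: L2_norm_on_def)

lemma norm_add_square:
  assumes "f \<in> A2 \<Omega>" "g \<in> A2 \<Omega>"
  shows "(L2_norm_on \<Omega> (\<lambda>z. f z + g z))\<^sup>2
    = (L2_norm_on \<Omega> f)\<^sup>2 + 2 * Re (A2_inner \<Omega> f g) + (L2_norm_on \<Omega> g)\<^sup>2"
proof -
  have "complex_of_real ((L2_norm_on \<Omega> (\<lambda>z. f z + g z))\<^sup>2)
      = A2_inner \<Omega> f f + A2_inner \<Omega> f g + cnj (A2_inner \<Omega> f g) + A2_inner \<Omega> g g"
    using assms by (simp add: inner_self[symmetric] A2_add inner_add_left inner_add_right
        inner_commute[of f g] del: of_real_power)
  then have "Re (complex_of_real ((L2_norm_on \<Omega> (\<lambda>z. f z + g z))\<^sup>2))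
      = Re (A2_inner \<Omega> f f + A2_inner \<Omega> f g + cnj (A2_inner \<Omega> f g) + A2_inner \<Omega> g g)"
    by (rule arg_cong)
  then show ?thesis
    using assms by (simp add: inner_self del: of_real_power)
qed

lemma Cauchy_Schwarz:
  assumes f: "f \<in> A2 \<Omega>" and g: "g \<in> A2 \<Omega>"
  shows "cmod (A2_inner \<Omega> f g) \<le> L2_norm_on \<Omega> f * L2_norm_on \<Omega> g"
proof (cases "L2_norm_on \<Omega> g = 0")
  case True
  then have "g = (\<lambda>z. 0)" using norm_eq_0D[OF g] by blast
  then show ?thesis by (simp add: A2_inner_def)
next
  case False
  let ?b = "(L2_norm_on \<Omega> g)\<^sup>2" and ?c = "A2_inner \<Omega> f g"
  \<comment> \<open>The vector is |g|^2 times the component of f orthogonal to g; the factor avoids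
    dividing.\<close>
  have "0 \<le> (L2_norm_on \<Omega> (\<lambda>z. of_real ?b * f z + (- ?c) * g z))\<^sup>2"
    by simp
  also have "\<dots> = (?b * L2_norm_on \<Omega> f)\<^sup>2
      + 2 * Re (of_real ?b * (cnj (- ?c) * ?c)) + (cmod ?c * L2_norm_on \<Omega> g)\<^sup>2"
    unfolding norm_add_square[OF A2_cmult[OF f] A2_cmult[OF g]] norm_cmult
      inner_cmult_left[OF f A2_cmult[OF g]] inner_cmult_right[OF g f]
    by (simp add: norm_power)
  also have "cnj (- ?c) * ?c = of_real (- (cmod ?c)\<^sup>2)"
    by (simp add: complex_norm_square mult.commute del: of_real_power)
  also have "(?b * L2_norm_on \<Omega> f)\<^sup>2 + 2 * Re (of_real ?b * of_real (- (cmod ?c)\<^sup>2))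
      + (cmod ?c * L2_norm_on \<Omega> g)\<^sup>2 = ?b * (?b * (L2_norm_on \<Omega> f)\<^sup>2 - (cmod ?c)\<^sup>2)"
    by (simp only: of_real_mult[symmetric] Re_complex_of_real) (simp add: power2_eq_square algebra_simps)
  finally have "(cmod ?c)\<^sup>2 \<le> ?b * (L2_norm_on \<Omega> f)\<^sup>2"
    using False by (simp add: zero_le_mult_iff not_less)
  then have "(cmod ?c)\<^sup>2 \<le> (L2_norm_on \<Omega> f * L2_norm_on \<Omega> g)\<^sup>2"
    by (simp add: power_mult_distrib mult.commute)
  then show ?thesis
    by (rule power2_le_imp_le) simp
qed

text \<open>Halving the radius leaves room for a ball of radius r/2 around each x, so K, the inverse
  square root of its volume, is independent of x. This uniformity makes convergence in norm locally
  uniform.\<close>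

lemma evaluation_bounded_locally:
  assumes "z \<in> \<Omega>"
  obtains r K where "0 < r" "cball z r \<subseteq> \<Omega>" "0 < K"
    "\<And>f x. f \<in> A2 \<Omega> \<Longrightarrow> x \<in> cball z r \<Longrightarrow> cmod (f x) \<le> K * L2_norm_on \<Omega> f"
proof -
  obtain r where r: "r > 0" "cball z r \<subseteq> \<Omega>"
    using assms open_domain open_contains_cball by blast
  define V where "V = measure lborel (ball (0::complex ^ 'n) (r / 2))"
  have "V > 0"
    unfolding V_def using r(1) by (intro content_ball_pos) simp
  show thesis
  proof (rule that)
    show "0 < r / 2" "0 < 1 / sqrt V" "cball z (r / 2) \<subseteq> \<Omega>"
      using r \<open>V > 0\<close> subset_cball[of "r / 2" r z] by auto
    fix f x assume f: "f \<in> A2 \<Omega>" and x: "x \<in> cball z (r / 2)"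
    have "cball x (r / 2) \<subseteq> cball z r"
    proof
      fix y assume "y \<in> cball x (r / 2)"
      then show "y \<in> cball z r"
        using x dist_triangle[of z y x] by simp
    qed
    then have "(cmod (f x))\<^sup>2 * V \<le> (L2_norm_on \<Omega> f)\<^sup>2"
      unfolding V_def using r by (intro point_evaluation_bound f) auto
    then have "(cmod (f x) * sqrt V)\<^sup>2 \<le> (L2_norm_on \<Omega> f)\<^sup>2"
      using \<open>V > 0\<close> by (simp add: power_mult_distrib)
    then have "cmod (f x) * sqrt V \<le> L2_norm_on \<Omega> f"
      by (rule power2_le_imp_le) simp
    then show "cmod (f x) \<le> 1 / sqrt V * L2_norm_on \<Omega> f"
      using \<open>V > 0\<close> by (simp add: pos_le_divide_eq)
  qed
qed

text \<open>Evaluations are continuous. This ties the pointwise series defining the kernel to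
  expansions in norm, and makes the sum of an expansion unique as a function.\<close>

lemma A2_sums_pointwise:
  assumes u: "\<And>j. u j \<in> A2 \<Omega>" and g: "A2_sums \<Omega> u g"
  shows "(\<lambda>j. u j z) sums g z"
proof (cases "z \<in> \<Omega>")
  case True
  then obtain r K where K: "0 < r" "\<And>f x. f \<in> A2 \<Omega> \<Longrightarrow> x \<in> cball z r \<Longrightarrow> cmod (f x) \<le> K * L2_norm_on \<Omega> f"
    using evaluation_bounded_locally by metis
  let ?d = "\<lambda>N z. g z - (\<Sum>j<N. u j z)"
  have gA: "g \<in> A2 \<Omega>" and lim: "(\<lambda>N. L2_norm_on \<Omega> (?d N)) \<longlonglongrightarrow> 0"
    using g by (auto simp: A2_sums_def)
  have "?d N \<in> A2 \<Omega>" for N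
    by (intro A2_diff A2_sum gA u)
  then have "cmod (?d N z) \<le> K * L2_norm_on \<Omega> (?d N)" for N
    using K(1) by (intro K(2)) auto
  then have "\<forall>\<^sub>F N in sequentially. cmod (?d N z) \<le> K * L2_norm_on \<Omega> (?d N)"
    by simp
  moreover have "(\<lambda>N. K * L2_norm_on \<Omega> (?d N)) \<longlonglongrightarrow> 0"
    using tendsto_mult_left[OF lim, of K] by simp
  ultimately have "(\<lambda>N. ?d N z) \<longlonglongrightarrow> 0"
    by (rule Lim_null_comparison)
  from tendsto_diff[OF tendsto_const[of "g z"] this] show ?thesis
    by (simp add: sums_def)
next
  case False
  then have "u j z = 0" "g z = 0" for j
    using A2_D(3)[OF u] g A2_D(3)[of g] by (auto simp: A2_sums_def)
  then show ?thesis by simp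
qed

lemma A2_sums_unique:
  assumes "\<And>j. u j \<in> A2 \<Omega>" "A2_sums \<Omega> u g" "A2_sums \<Omega> u h"
  shows "g = h"
  using A2_sums_pointwise[OF assms(1,2)] A2_sums_pointwise[OF assms(1,3)] sums_unique2 by blast

section \<open>The dual space and the Riesz isometry\<close>

lemma inner_functional_A2 [simp]: "f \<in> A2 \<Omega> \<Longrightarrow> inner_functional \<Omega> g f = A2_inner \<Omega> f g"
  by (simp add: inner_functional_def)

lemma inner_functional_in_dual:
  assumes g: "g \<in> A2 \<Omega>"
  shows "inner_functional \<Omega> g \<in> A2_dual \<Omega>"
  unfolding A2_dual_def
proof (intro CollectI conjI)
  show "\<exists>C. \<forall>f\<in>A2 \<Omega>. cmod (inner_functional \<Omega> g f) \<le> C * L2_norm_on \<Omega> f"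
    using Cauchy_Schwarz[OF _ g] by (intro exI[of _ "L2_norm_on \<Omega> g"]) (simp add: mult.commute)
qed (use g in \<open>auto simp: A2_add A2_cmult inner_add_left inner_cmult_left inner_functional_def\<close>)

lemma inner_functional_cmult:
  assumes g: "g \<in> A2 \<Omega>"
  shows "inner_functional \<Omega> (\<lambda>z. c * g z) = (\<lambda>f. cnj c * inner_functional \<Omega> g f)"
  using g by (auto simp: inner_functional_def inner_cmult_right)

lemma inner_functional_add:
  assumes "g \<in> A2 \<Omega>" "h \<in> A2 \<Omega>"
  shows "inner_functional \<Omega> (\<lambda>z. g z + h z) = (\<lambda>f. inner_functional \<Omega> g f + inner_functional \<Omega> h f)"
  using assms by (auto simp: inner_functional_def inner_add_right)

lemma inner_functional_inj:
  assumes g: "g \<in> A2 \<Omega>" and h: "h \<in> A2 \<Omega>" and eq: "inner_functional \<Omega> g = inner_functional \<Omega> h"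
  shows "g = h"
proof -
  let ?d = "\<lambda>z. g z - h z"
  have d: "?d \<in> A2 \<Omega>" using g h by (rule A2_diff)
  have "A2_inner \<Omega> g ?d = A2_inner \<Omega> h ?d"
    using inner_commute[OF d g] inner_commute[OF d h] fun_cong[OF eq, of ?d] d by simp
  then have "A2_inner \<Omega> ?d ?d = 0"
    using inner_diff_left[OF g h d] by simp
  then have "L2_norm_on \<Omega> ?d = 0"
    using inner_self[OF d] by simp
  then have "?d = (\<lambda>z. 0)"
    by (rule norm_eq_0D[OF d])
  then show ?thesis by (auto simp: fun_eq_iff)
qed

text \<open>Cauchy-Schwarz is the upper bound; it is attained at g divided by its norm, or at 0 when
  that norm is 0. Agreement of L with the inner product is asked on \<open>A2 \<Omega>\<close> only,
  so that L may be a functional minus a partial sum.\<close>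

lemma dual_norm_eq:
  assumes g: "g \<in> A2 \<Omega>" and L: "\<And>f. f \<in> A2 \<Omega> \<Longrightarrow> L f = A2_inner \<Omega> f g"
  shows "dual_norm \<Omega> L = L2_norm_on \<Omega> g"
proof -
  let ?B = "{f \<in> A2 \<Omega>. L2_norm_on \<Omega> f \<le> 1}"
  have upper: "cmod (L f) \<le> L2_norm_on \<Omega> g" if "f \<in> ?B" for f
  proof -
    have "cmod (L f) \<le> L2_norm_on \<Omega> f * L2_norm_on \<Omega> g"
      using that Cauchy_Schwarz[OF _ g] L by simp
    also have "\<dots> \<le> 1 * L2_norm_on \<Omega> g"
      using that by (intro mult_right_mono) auto
    finally show ?thesis by simp
  qed
  have "\<exists>f\<in>?B. L2_norm_on \<Omega> g \<le> cmod (L f)"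
  proof (cases "L2_norm_on \<Omega> g = 0")
    case True
    then show ?thesis using A2_zero by (intro bexI[of _ "\<lambda>z. 0"]) auto
  next
    case False
    let ?f = "\<lambda>z. of_real (1 / L2_norm_on \<Omega> g) * g z"
    have f: "?f \<in> A2 \<Omega>" using g by (rule A2_cmult)
    have "L2_norm_on \<Omega> ?f = 1"
      using False by (simp only: norm_cmult norm_of_real) simp
    moreover have "L ?f = of_real (L2_norm_on \<Omega> g)"
      using False L[OF f] inner_cmult_left[OF g g, of "of_real (1 / L2_norm_on \<Omega> g)"]
      by (simp add: inner_self[OF g] power2_eq_square)
    ultimately show ?thesis using f by (intro bexI[of _ ?f]) auto
  qed
  then obtain f where f: "f \<in> ?B" "L2_norm_on \<Omega> g \<le> cmod (L f)" by blast
  show ?thesis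
    unfolding dual_norm_def
  proof (rule antisym)
    show "(SUP f\<in>?B. cmod (L f)) \<le> L2_norm_on \<Omega> g"
      using f(1) upper by (intro cSUP_least) auto
    have "bdd_above ((\<lambda>f. cmod (L f)) ` ?B)"
      using upper by (intro bdd_aboveI2)
    then have "cmod (L f) \<le> (SUP f\<in>?B. cmod (L f))"
      using f(1) by (intro cSup_upper imageI)
    with f(2) show "L2_norm_on \<Omega> g \<le> (SUP f\<in>?B. cmod (L f))" by (rule order_trans)
  qed
qed

text \<open>The remainders correspond under the Riesz isometry, so the two sequences of norms are
  equal term by term. Conjugates appear because the representing vector stands in the second
  argument of the inner product.\<close>

lemma dual_sums_iff:
  assumes g: "g \<in> A2 \<Omega>" and s: "\<And>j. s j \<in> A2 \<Omega>"
  shows "dual_sums \<Omega> (\<lambda>j f. a j * inner_functional \<Omega> (s j) f) (inner_functional \<Omega> g)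
    \<longleftrightarrow> A2_sums \<Omega> (\<lambda>j z. cnj (a j) * s j z) g"
proof -
  have "dual_norm \<Omega> (\<lambda>f. inner_functional \<Omega> g f - (\<Sum>j<N. a j * inner_functional \<Omega> (s j) f))
      = L2_norm_on \<Omega> (\<lambda>z. g z - (\<Sum>j<N. cnj (a j) * s j z))" for N
  proof (rule dual_norm_eq)
    let ?p = "\<lambda>z. \<Sum>j<N. cnj (a j) * s j z"
    have p: "?p \<in> A2 \<Omega>" by (intro A2_sum A2_cmult s)
    show "(\<lambda>z. g z - ?p z) \<in> A2 \<Omega>" using g p by (rule A2_diff)
    fix f assume f: "f \<in> A2 \<Omega>"
    have "A2_inner \<Omega> f (\<lambda>z. g z - ?p z) = cnj (A2_inner \<Omega> g f - A2_inner \<Omega> ?p f)"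
      using inner_commute[OF A2_diff[OF g p] f] inner_diff_left[OF g p f] by simp
    also have "A2_inner \<Omega> ?p f = (\<Sum>j<N. cnj (a j) * A2_inner \<Omega> (s j) f)"
      using f s by (subst inner_sum_left) (auto simp: A2_cmult inner_cmult_left)
    also have "cnj (A2_inner \<Omega> g f - \<dots>) = A2_inner \<Omega> f g - (\<Sum>j<N. a j * A2_inner \<Omega> f (s j))"
      using inner_commute[OF f g] inner_commute[OF f s] by (simp add: cnj_sum)
    finally show "inner_functional \<Omega> g f - (\<Sum>j<N. a j * inner_functional \<Omega> (s j) f)
        = A2_inner \<Omega> f (\<lambda>z. g z - ?p z)"
      using f by simp
  qed
  then show ?thesis
    using g inner_functional_in_dual[OF g] by (simp add: dual_sums_def A2_sums_def)
qed

end

section \<open>Orthonormal bases\<close>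

locale bergman_basis = bergman_space +
  fixes s :: "nat \<Rightarrow> complex ^ 'n \<Rightarrow> complex"
  assumes orthonormal_basis: "orthonormal_basis_A2 \<Omega> s"
begin

lemma basis_A2: "s j \<in> A2 \<Omega>"
  and basis_inner: "A2_inner \<Omega> (s i) (s j) = (if i = j then 1 else 0)"
  and basis_dense: "f \<in> A2 \<Omega> \<Longrightarrow> 0 < \<epsilon> \<Longrightarrow> \<exists>N c. L2_norm_on \<Omega> (\<lambda>z. f z - (\<Sum>j<N. c j * s j z)) < \<epsilon>"
  using orthonormal_basis unfolding orthonormal_basis_A2_def by auto

lemma combination_A2: "(\<lambda>z. \<Sum>j\<in>J. c j * s j z) \<in> A2 \<Omega>"
  by (intro A2_sum A2_cmult basis_A2)

lemma combination_inner_basis: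
  assumes "finite J"
  shows "A2_inner \<Omega> (\<lambda>z. \<Sum>j\<in>J. c j * s j z) (s k) = (if k \<in> J then c k else 0)"
proof -
  have "A2_inner \<Omega> (\<lambda>z. \<Sum>j\<in>J. c j * s j z) (s k) = (\<Sum>j\<in>J. if j = k then c j else 0)"
    by (subst inner_sum_left)
      (auto simp: basis_A2 A2_cmult inner_cmult_left basis_inner intro!: sum.cong)
  then show ?thesis using assms by simp
qed

lemma combination_norm_square:
  assumes "finite J"
  shows "(L2_norm_on \<Omega> (\<lambda>z. \<Sum>j\<in>J. c j * s j z))\<^sup>2 = (\<Sum>j\<in>J. (cmod (c j))\<^sup>2)"
proof -
  let ?p = "\<lambda>z. \<Sum>j\<in>J. c j * s j z"
  have "complex_of_real ((L2_norm_on \<Omega> ?p)\<^sup>2) = A2_inner \<Omega> ?p ?p"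
    by (rule inner_self[OF combination_A2, symmetric])
  also have "\<dots> = (\<Sum>j\<in>J. c j * A2_inner \<Omega> (s j) ?p)"
    by (subst inner_sum_left) (auto simp: basis_A2 A2_cmult inner_cmult_left combination_A2)
  also have "\<dots> = (\<Sum>j\<in>J. complex_of_real ((cmod (c j))\<^sup>2))"
    using assms
    by (intro sum.cong refl)
      (simp add: inner_commute[OF combination_A2 basis_A2] combination_inner_basis complex_norm_square
        del: of_real_power)
  finally show ?thesis
    by (simp only: of_real_sum[symmetric] of_real_eq_iff)
qed

lemma A2_sums_coeff:
  assumes g: "A2_sums \<Omega> (\<lambda>j z. c j * s j z) g"
  shows "A2_inner \<Omega> g (s k) = c k"
proof -
  let ?d = "\<lambda>N z. g z - (\<Sum>j<N. c j * s j z)"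
  have gA: "g \<in> A2 \<Omega>" and lim: "(\<lambda>N. L2_norm_on \<Omega> (?d N)) \<longlonglongrightarrow> 0"
    using g by (auto simp: A2_sums_def)
  have sk: "L2_norm_on \<Omega> (s k) = 1"
    using combination_norm_square[of "{k}" "\<lambda>_. 1"] by (simp add: power2_eq_1_iff)
      (metis L2_norm_nonneg less_eq_real_def neg_0_le_iff_le not_one_le_zero)
  \<comment> \<open>Once N exceeds k, the k-th coefficient of the remainder no longer depends on N,
    while the remainder tends to 0.\<close>
  have "cmod (A2_inner \<Omega> g (s k) - c k) \<le> L2_norm_on \<Omega> (?d N)" if "N > k" for N
    using Cauchy_Schwarz[OF A2_diff[OF gA combination_A2[of c "{..<N}"]] basis_A2[of k]] that
    by (simp add: inner_diff_left[OF gA combination_A2 basis_A2] combination_inner_basis sk)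
  then have "\<forall>\<^sub>F N in sequentially. cmod (A2_inner \<Omega> g (s k) - c k) \<le> L2_norm_on \<Omega> (?d N)"
    using eventually_gt_at_top[of k] by (rule eventually_mono[rotated])
  with lim have "cmod (A2_inner \<Omega> g (s k) - c k) \<le> 0"
    by (rule tendsto_lowerbound) simp
  then show ?thesis by simp
qed

lemma norm_square_diff_partial:
  assumes "M \<le> N"
  shows "(L2_norm_on \<Omega> (\<lambda>z. (\<Sum>j<N. c j * s j z) - (\<Sum>j<M. c j * s j z)))\<^sup>2
    = (\<Sum>j\<in>{M..<N}. (cmod (c j))\<^sup>2)"
proof -
  have "{..<N} - {..<M} = {M..<N}" by auto
  then have "(\<Sum>j<N. c j * s j z) - (\<Sum>j<M. c j * s j z) = (\<Sum>j\<in>{M..<N}. c j * s j z)" for z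
    using assms by (subst sum_diff[symmetric]) auto
  then show ?thesis by (simp add: combination_norm_square)
qed

text \<open>The candidate is the pointwise limit. Evaluation bounds turn the Cauchy property in norm
  into locally uniform convergence, so the candidate is holomorphic; Fatou's lemma, with M fixed and
  N growing, returns square integrability and convergence in norm.\<close>

lemma Riesz_Fischer:
  assumes sum: "summable (\<lambda>j. (cmod (c j))\<^sup>2)"
  shows "\<exists>g. A2_sums \<Omega> (\<lambda>j z. c j * s j z) g"
proof -
  let ?p = "\<lambda>N z. \<Sum>j<N. c j * s j z"
  let ?\<sigma> = "\<lambda>N. \<Sum>j<N. (cmod (c j))\<^sup>2"
  define g where "g = (\<lambda>z. lim (\<lambda>N. ?p N z))"
  \<comment> \<open>The remaining sum of squares bounds the squared distance from the M-th to every
    later partial sum.\<close>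
  define tail where "tail M = (\<Sum>j. (cmod (c j))\<^sup>2) - ?\<sigma> M" for M
  have pA: "?p N \<in> A2 \<Omega>" for N by (rule combination_A2)
  have dA: "(\<lambda>z. ?p N z - ?p M z) \<in> A2 \<Omega>" for M N by (intro A2_diff pA)
  have tail: "tail \<longlonglongrightarrow> 0"
    unfolding tail_def using tendsto_diff[OF tendsto_const[of "\<Sum>j. (cmod (c j))\<^sup>2"] summable_LIMSEQ[OF sum]]
    by simp
  have diff: "(L2_norm_on \<Omega> (\<lambda>z. ?p N z - ?p M z))\<^sup>2 \<le> tail M" if "M \<le> N" for M N
  proof -
    have "(\<Sum>j\<in>{M..<N}. (cmod (c j))\<^sup>2) = ?\<sigma> N - ?\<sigma> M"
      using sum_diff_nat_ivl[of 0 M N "\<lambda>j. (cmod (c j))\<^sup>2"] that by (simp add: atLeast0LessThan)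
    moreover have "?\<sigma> N \<le> (\<Sum>j. (cmod (c j))\<^sup>2)"
      by (intro sum_le_suminf sum) auto
    ultimately show ?thesis
      using norm_square_diff_partial[OF that, of c] by (simp add: tail_def)
  qed
  have loc: "\<exists>r>0. cball z r \<subseteq> \<Omega> \<and> uniform_limit (cball z r) ?p g sequentially" if z: "z \<in> \<Omega>" for z
  proof -
    obtain r K where K: "0 < r" "cball z r \<subseteq> \<Omega>" "0 < K"
      "\<And>f x. f \<in> A2 \<Omega> \<Longrightarrow> x \<in> cball z r \<Longrightarrow> cmod (f x) \<le> K * L2_norm_on \<Omega> f"
      using evaluation_bounded_locally[OF z] by metis
    have "uniformly_Cauchy_on (cball z r) ?p"
    proof (rule uniformly_Cauchy_onI')
      fix e :: real assume "e > 0"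
      then have "(e / K)\<^sup>2 > 0" using K(3) by simp
      then obtain M0 where M0: "\<And>M. M \<ge> M0 \<Longrightarrow> tail M < (e / K)\<^sup>2"
        using order_tendstoD(2)[OF tail] unfolding eventually_sequentially by blast
      have "dist (?p M x) (?p N x) < e" if "M \<ge> M0" "M < N" "x \<in> cball z r" for M N x
      proof -
        have "(L2_norm_on \<Omega> (\<lambda>z. ?p N z - ?p M z))\<^sup>2 < (e / K)\<^sup>2"
          using diff[of M N] M0[of M] that by linarith
        then have "L2_norm_on \<Omega> (\<lambda>z. ?p N z - ?p M z) < e / K"
          using \<open>e > 0\<close> K(3) by (intro power2_less_imp_less[where y = "e / K"]) auto
        then have "K * L2_norm_on \<Omega> (\<lambda>z. ?p N z - ?p M z) < e"
          using K(3) by (simp add: pos_less_divide_eq mult.commute)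
        then show ?thesis
          using K(4)[OF dA that(3), of N M] by (simp add: dist_norm norm_minus_commute)
      qed
      then show "\<exists>M. \<forall>x\<in>cball z r. \<forall>m\<ge>M. \<forall>n>m. dist (?p m x) (?p n x) < e"
        by blast
    qed
    then have "uniform_limit (cball z r) ?p g sequentially"
      unfolding g_def
      using Cauchy_uniformly_convergent uniformly_convergent_uniform_limit_iff by blast
    then show ?thesis using K by blast
  qed
  have hol: "holomorphic_Cn g \<Omega>"
  proof -
    have "holomorphic_Cn g {z}" if z: "z \<in> \<Omega>" for z
    proof -
      obtain r where r: "r > 0" "cball z r \<subseteq> \<Omega>" "uniform_limit (cball z r) ?p g sequentially"
        using loc[OF z] by (elim exE conjE)
      show ?thesis
        using holomorphic_Cn_subset[OF A2_D(1)[OF pA] r(2)] r(1,3)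
        by (rule holomorphic_Cn_uniform_limit)
    qed
    then show ?thesis unfolding holomorphic_Cn_def by simp
  qed
  have off: "g z = 0" if "z \<notin> \<Omega>" for z
    unfolding g_def using A2_D(3)[OF pA that] by simp
  have pt: "(\<lambda>N. ?p N z) \<longlonglongrightarrow> g z" for z
  proof (cases "z \<in> \<Omega>")
    case True
    then obtain r where "r > 0" "uniform_limit (cball z r) ?p g sequentially"
      using loc by blast
    then show ?thesis
      by (intro tendsto_uniform_limitI) auto
  next
    case False
    then show ?thesis using A2_D(3)[OF pA False] off by simp
  qed
  have g[measurable]: "g \<in> borel_measurable borel"
    using hol off by (rule holomorphic_Cn_borel_measurable)
  have p[measurable]: "?p N \<in> borel_measurable borel" for N
    using A2_D(4)[OF pA] .
  have fatou: "(\<integral>\<^sup>+z. ennreal ((cmod (g z - ?p M z))\<^sup>2) \<partial>lborel) \<le> ennreal (tail M)" for M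
  proof -
    have "(\<lambda>N. ennreal ((cmod (?p N z - ?p M z))\<^sup>2)) \<longlonglongrightarrow> ennreal ((cmod (g z - ?p M z))\<^sup>2)" for z
      by (intro tendsto_intros pt)
    then have "(\<integral>\<^sup>+z. ennreal ((cmod (g z - ?p M z))\<^sup>2) \<partial>lborel)
        = (\<integral>\<^sup>+z. liminf (\<lambda>N. ennreal ((cmod (?p N z - ?p M z))\<^sup>2)) \<partial>lborel)"
      by (intro nn_integral_cong lim_imp_Liminf[symmetric]) auto
    also have "\<dots> \<le> liminf (\<lambda>N. \<integral>\<^sup>+z. ennreal ((cmod (?p N z - ?p M z))\<^sup>2) \<partial>lborel)"
      by (rule nn_integral_liminf) measurable
    also have "\<dots> = liminf (\<lambda>N. ennreal ((L2_norm_on \<Omega> (\<lambda>z. ?p N z - ?p M z))\<^sup>2))"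
      using A2_D(2)[OF dA] by (simp add: norm_square_eq[OF dA] nn_integral_eq_integral)
    also have "\<dots> \<le> limsup (\<lambda>N. ennreal ((L2_norm_on \<Omega> (\<lambda>z. ?p N z - ?p M z))\<^sup>2))"
      by (rule Liminf_le_Limsup) simp
    also have "\<dots> \<le> ennreal (tail M)"
      using diff by (intro Limsup_bounded eventually_sequentiallyI[of M] ennreal_leI)
    finally show ?thesis .
  qed
  \<comment> \<open>For M = 0 the partial sum is empty and the Fatou bound concerns g
    itself.\<close>
  have "integrable lborel (\<lambda>z. (cmod (g z))\<^sup>2)"
  proof (rule integrableI_bounded)
    show "(\<integral>\<^sup>+z. ennreal (norm ((cmod (g z))\<^sup>2)) \<partial>lborel) < \<infinity>"
      using fatou[of 0] by (simp add: le_less_trans[OF _ ennreal_less_top])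
  qed measurable
  then have gA: "g \<in> A2 \<Omega>"
    using hol off unfolding A2_iff by blast
  have bound: "(L2_norm_on \<Omega> (\<lambda>z. g z - ?p M z))\<^sup>2 \<le> tail M" for M
  proof -
    have "(\<lambda>z. g z - ?p M z) \<in> A2 \<Omega>" by (intro A2_diff gA pA)
    then have "ennreal ((L2_norm_on \<Omega> (\<lambda>z. g z - ?p M z))\<^sup>2) \<le> ennreal (tail M)"
      using fatou[of M] by (simp add: norm_square_eq nn_integral_eq_integral[symmetric] A2_D(2))
    moreover have "tail M \<ge> 0"
      by (rule order_trans[OF zero_le_power2 diff[of M M]]) simp
    ultimately show ?thesis by simp
  qed
  have "(\<lambda>M. (L2_norm_on \<Omega> (\<lambda>z. g z - ?p M z))\<^sup>2) \<longlonglongrightarrow> 0"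
    using bound by (intro tendsto_sandwich[OF _ _ tendsto_const tail]) auto
  from tendsto_real_sqrt[OF this] have "(\<lambda>M. L2_norm_on \<Omega> (\<lambda>z. g z - ?p M z)) \<longlonglongrightarrow> 0"
    by simp
  then show ?thesis
    using gA unfolding A2_sums_def by blast
qed

text \<open>The coefficients are forced by \<open>A2_inner \<Omega> (s j) g = L (s j)\<close>.
  Boundedness of L makes them square summable, and the resulting g represents L on finite
  combinations, hence everywhere by density.\<close>

lemma Riesz_representation:
  assumes L: "L \<in> A2_dual \<Omega>"
  shows "\<exists>g\<in>A2 \<Omega>. L = inner_functional \<Omega> g \<and> A2_sums \<Omega> (\<lambda>j z. cnj (L (s j)) * s j z) g"
proof -
  obtain C where C: "\<And>f. f \<in> A2 \<Omega> \<Longrightarrow> cmod (L f) \<le> C * L2_norm_on \<Omega> f"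
    using L unfolding A2_dual_def by blast
  have add: "L (\<lambda>z. f z + h z) = L f + L h" if "f \<in> A2 \<Omega>" "h \<in> A2 \<Omega>" for f h
    using L that unfolding A2_dual_def by blast
  have cmult: "L (\<lambda>z. c * f z) = c * L f" if "f \<in> A2 \<Omega>" for c f
    using L that unfolding A2_dual_def by blast
  have off: "L f = 0" if "f \<notin> A2 \<Omega>" for f
    using L that unfolding A2_dual_def by blast
  have comb: "L (\<lambda>z. \<Sum>j<N. c j * s j z) = (\<Sum>j<N. c j * L (s j))" for N c
  proof (induction N)
    case 0
    show ?case using cmult[OF A2_zero, of 0] by simp
  next
    case (Suc N)
    then show ?case by (simp add: add[OF combination_A2 A2_cmult[OF basis_A2]] cmult[OF basis_A2])
  qed
  let ?c = "\<lambda>j. cnj (L (s j))"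
  \<comment> \<open>L is tested on the combination with the candidate coefficients: its value there
    is the squared norm n^2 of that combination, so n^2 is at most C n.\<close>
  have "(\<Sum>j<N. (cmod (?c j))\<^sup>2) \<le> C\<^sup>2" for N
  proof -
    let ?f = "\<lambda>z. \<Sum>j<N. ?c j * s j z"
    let ?n = "L2_norm_on \<Omega> ?f"
    have "?n\<^sup>2 = (\<Sum>j<N. (cmod (?c j))\<^sup>2)"
      by (rule combination_norm_square) simp
    also have "\<dots> = cmod (\<Sum>j<N. complex_of_real ((cmod (?c j))\<^sup>2))"
      by (simp only: of_real_sum[symmetric] norm_of_real) (simp add: sum_nonneg)
    also have "(\<Sum>j<N. complex_of_real ((cmod (?c j))\<^sup>2)) = L ?f"
      by (simp only: comb complex_norm_square) (simp add: mult.commute)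
    also have "cmod \<dots> \<le> C * ?n" by (rule C[OF combination_A2])
    finally have "?n * ?n \<le> C * ?n" by (simp add: power2_eq_square)
    moreover have "0 < ?n \<or> ?n = 0" using L2_norm_nonneg[of ?f] by linarith
    ultimately have "?n \<le> C \<or> ?n = 0" by (auto simp: mult_le_cancel_right)
    then have "?n\<^sup>2 \<le> C\<^sup>2"
      using L2_norm_nonneg[of ?f] by (auto intro: power_mono)
    then show ?thesis
      using combination_norm_square[of "{..<N}" ?c] by simp
  qed
  then have "summable (\<lambda>j. (cmod (?c j))\<^sup>2)"
    by (intro summableI_nonneg_bounded) auto
  then have "\<exists>g. A2_sums \<Omega> (\<lambda>j z. ?c j * s j z) g"
    by (rule Riesz_Fischer)
  then obtain g where g: "A2_sums \<Omega> (\<lambda>j z. ?c j * s j z) g" ..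
  then have gA: "g \<in> A2 \<Omega>" by (simp add: A2_sums_def)
  have coeff: "A2_inner \<Omega> (s k) g = L (s k)" for k
    using inner_commute[OF gA basis_A2] A2_sums_coeff[OF g, of k] by simp
  have "L f = A2_inner \<Omega> f g" if f: "f \<in> A2 \<Omega>" for f
  proof -
    \<comment> \<open>An upper bound for C plus the norm of g; the absolute value and the 1 make it
      positive whatever the sign of C.\<close>
    let ?K = "\<bar>C\<bar> + L2_norm_on \<Omega> g + 1"
    have "?K > 0" using L2_norm_nonneg[of g] by linarith
    have "cmod (L f - A2_inner \<Omega> f g) \<le> e" if "e > 0" for e
    proof -
      obtain N c where N: "L2_norm_on \<Omega> (\<lambda>z. f z - (\<Sum>j<N. c j * s j z)) < e / ?K"
        using basis_dense[OF f divide_pos_pos[OF \<open>e > 0\<close> \<open>?K > 0\<close>]] by (elim exE)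
      let ?p = "\<lambda>z. \<Sum>j<N. c j * s j z"
      let ?d = "\<lambda>z. f z - ?p z"
      have p: "?p \<in> A2 \<Omega>" by (rule combination_A2)
      then have d: "?d \<in> A2 \<Omega>" using f by (intro A2_diff)
      have "A2_inner \<Omega> ?p g = (\<Sum>j<N. c j * L (s j))"
        by (subst inner_sum_left) (auto simp: A2_cmult basis_A2 gA inner_cmult_left coeff)
      also have "\<dots> = L ?p" by (rule comb[symmetric])
      finally have "A2_inner \<Omega> ?p g = L ?p" .
      moreover have "L f = L ?p + L ?d" using add[OF p d] by simp
      moreover have "A2_inner \<Omega> f g = A2_inner \<Omega> ?p g + A2_inner \<Omega> ?d g"
        using inner_add_left[OF p d gA] by simp
      ultimately have "cmod (L f - A2_inner \<Omega> f g) = cmod (L ?d - A2_inner \<Omega> ?d g)"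
        by simp
      also have "\<dots> \<le> cmod (L ?d) + cmod (A2_inner \<Omega> ?d g)"
        by (rule norm_triangle_ineq4)
      also have "\<dots> \<le> C * L2_norm_on \<Omega> ?d + L2_norm_on \<Omega> ?d * L2_norm_on \<Omega> g"
        by (intro add_mono C d Cauchy_Schwarz gA)
      also have "\<dots> = (C + L2_norm_on \<Omega> g) * L2_norm_on \<Omega> ?d"
        by (simp add: algebra_simps)
      also have "\<dots> \<le> ?K * L2_norm_on \<Omega> ?d"
        by (intro mult_right_mono) auto
      also have "\<dots> \<le> ?K * (e / ?K)"
        using N \<open>?K > 0\<close> by (intro mult_left_mono) auto
      also have "\<dots> = e" using \<open>?K > 0\<close> by simp
      finally show ?thesis .
    qed
    then have "cmod (L f - A2_inner \<Omega> f g) \<le> 0"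
      by (rule field_le_epsilon) simp
    then show ?thesis by simp
  qed
  then have "L = inner_functional \<Omega> g"
    using off unfolding inner_functional_def fun_eq_iff by presburger
  then show ?thesis using gA g by (intro bexI conjI)
qed

text \<open>The Riesz representation of the functional of g comes with an expansion; injectivity
  identifies the represented vector with g.\<close>

lemma A2_sums_coefficients:
  assumes g: "g \<in> A2 \<Omega>"
  shows "A2_sums \<Omega> (\<lambda>j z. A2_inner \<Omega> g (s j) * s j z) g"
proof -
  obtain h where h: "h \<in> A2 \<Omega>" "inner_functional \<Omega> g = inner_functional \<Omega> h"
    "A2_sums \<Omega> (\<lambda>j z. cnj (inner_functional \<Omega> g (s j)) * s j z) h"
    using Riesz_representation[OF inner_functional_in_dual[OF g]] by blast
  have "h = g" using inner_functional_inj[OF g h(1,2)] by simp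
  then show ?thesis
    using h(3) basis_A2 by (simp add: inner_commute[OF basis_A2 g, symmetric])
qed

text \<open>The Fourier coefficients of g witness existence. For uniqueness, any sequence expanding
  the functional expands g as well by \<open>dual_sums_iff\<close>, so a second sum of the same
  series must be g.\<close>

lemma dual_iso_inner_functional:
  assumes g: "g \<in> A2 \<Omega>"
  shows "dual_iso \<Omega> s (inner_functional \<Omega> g) = g"
proof -
  note iff = dual_sums_iff[OF g, of s, OF basis_A2]
  let ?a = "\<lambda>j. cnj (A2_inner \<Omega> g (s j))"
  have g_sums: "A2_sums \<Omega> (\<lambda>j z. cnj (?a j) * s j z) g"
    using A2_sums_coefficients[OF g] by simp
  show ?thesis
    unfolding dual_iso_def
  proof (rule the_equality)
    show "\<exists>a. dual_sums \<Omega> (\<lambda>j f. a j * inner_functional \<Omega> (s j) f) (inner_functional \<Omega> g) \<and>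
        A2_sums \<Omega> (\<lambda>j z. cnj (a j) * s j z) g"
      using g_sums by (intro exI[of _ ?a] conjI) (simp only: iff)
  next
    fix h
    assume "\<exists>a. dual_sums \<Omega> (\<lambda>j f. a j * inner_functional \<Omega> (s j) f) (inner_functional \<Omega> g) \<and>
        A2_sums \<Omega> (\<lambda>j z. cnj (a j) * s j z) h"
    then obtain a where "A2_sums \<Omega> (\<lambda>j z. cnj (a j) * s j z) g" "A2_sums \<Omega> (\<lambda>j z. cnj (a j) * s j z) h"
      by (auto simp only: iff)
    then show "h = g"
      using A2_sums_unique[of "\<lambda>j z. cnj (a j) * s j z" h g] A2_cmult[OF basis_A2] by simp
  qed
qed

lemma inner_functional_dual_iso:
  "L \<in> A2_dual \<Omega> \<Longrightarrow> dual_iso \<Omega> s L \<in> A2 \<Omega> \<and> inner_functional \<Omega> (dual_iso \<Omega> s L) = L"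
  using Riesz_representation[of L] dual_iso_inner_functional by auto

lemma A2_dual_cmult:
  assumes "L \<in> A2_dual \<Omega>"
  shows "(\<lambda>f. c * L f) \<in> A2_dual \<Omega>"
  using assms inner_functional_dual_iso[OF assms] A2_cmult[of "dual_iso \<Omega> s L" "cnj c"]
    inner_functional_cmult[of "dual_iso \<Omega> s L" "cnj c"]
    inner_functional_in_dual[of "\<lambda>z. cnj c * dual_iso \<Omega> s L z"] by simp

lemma conj_linear_iso_dual_iso: "conj_linear_iso (A2_dual \<Omega>) (A2 \<Omega>) (dual_iso \<Omega> s)"
  unfolding conj_linear_iso_def
proof (intro conjI ballI allI)
  show "bij_betw (dual_iso \<Omega> s) (A2_dual \<Omega>) (A2 \<Omega>)"
    by (rule bij_betw_byWitness[where f' = "inner_functional \<Omega>"])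
      (auto simp: inner_functional_dual_iso dual_iso_inner_functional inner_functional_in_dual)
next
  fix L M assume "L \<in> A2_dual \<Omega>" "M \<in> A2_dual \<Omega>"
  then have g: "dual_iso \<Omega> s L \<in> A2 \<Omega>" and L: "inner_functional \<Omega> (dual_iso \<Omega> s L) = L"
    and h: "dual_iso \<Omega> s M \<in> A2 \<Omega>" and M: "inner_functional \<Omega> (dual_iso \<Omega> s M) = M"
    using inner_functional_dual_iso by auto
  show "dual_iso \<Omega> s (\<lambda>f. L f + M f) = (\<lambda>z. dual_iso \<Omega> s L z + dual_iso \<Omega> s M z)"
    using dual_iso_inner_functional[OF A2_add[OF g h]] inner_functional_add[OF g h] by (simp add: L M)
next
  fix c L assume "L \<in> A2_dual \<Omega>"
  then have g: "dual_iso \<Omega> s L \<in> A2 \<Omega>" and L: "inner_functional \<Omega> (dual_iso \<Omega> s L) = L"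
    using inner_functional_dual_iso by auto
  show "dual_iso \<Omega> s (\<lambda>f. c * L f) = (\<lambda>z. cnj c * dual_iso \<Omega> s L z)"
    using dual_iso_inner_functional[OF A2_cmult[OF g, of "cnj c"]] inner_functional_cmult[OF g, of "cnj c"]
    by (simp add: L)
qed

text \<open>The reproducing kernel at z, obtained as the Riesz vector of evaluation; its
  coefficients are the conjugated values of the basis at z.\<close>

lemma evaluation_representer:
  assumes z: "z \<in> \<Omega>"
  obtains k where "k \<in> A2 \<Omega>" "\<And>f. f \<in> A2 \<Omega> \<Longrightarrow> A2_inner \<Omega> f k = f z"
    "A2_sums \<Omega> (\<lambda>j \<xi>. cnj (s j z) * s j \<xi>) k"
proof -
  \<comment> \<open>The value 0 outside \<open>A2 \<Omega>\<close> follows the convention of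
    \<open>A2_dual\<close>, so that the representation is an equality of functions.\<close>
  let ?E = "\<lambda>f. if f \<in> A2 \<Omega> then f z else 0"
  obtain r K where K: "0 < r" "\<And>f x. f \<in> A2 \<Omega> \<Longrightarrow> x \<in> cball z r \<Longrightarrow> cmod (f x) \<le> K * L2_norm_on \<Omega> f"
    using evaluation_bounded_locally[OF z] by metis
  have "?E \<in> A2_dual \<Omega>"
    unfolding A2_dual_def
  proof (intro CollectI conjI)
    show "\<exists>C. \<forall>f\<in>A2 \<Omega>. cmod (?E f) \<le> C * L2_norm_on \<Omega> f"
      using K by (intro exI[of _ K]) auto
  qed (auto simp: A2_add A2_cmult)
  then obtain k where k: "k \<in> A2 \<Omega>" "?E = inner_functional \<Omega> k"
    "A2_sums \<Omega> (\<lambda>j \<xi>. cnj (?E (s j)) * s j \<xi>) k"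
    using Riesz_representation by blast
  show thesis
  proof (rule that[OF k(1)])
    show "A2_inner \<Omega> f k = f z" if "f \<in> A2 \<Omega>" for f
      using fun_cong[OF k(2), of f] that by simp
    show "A2_sums \<Omega> (\<lambda>j \<xi>. cnj (s j z) * s j \<xi>) k"
      using k(3) basis_A2 by simp
  qed
qed

text \<open>A competing sum of the series is itself represented by a vector of the space, and that
  vector has the same expansion as k.\<close>

lemma bergman_bochner_eq:
  assumes k: "k \<in> A2 \<Omega>" "A2_sums \<Omega> (\<lambda>j \<xi>. cnj (s j z) * s j \<xi>) k"
  shows "bergman_bochner \<Omega> s z = proj_class (inner_functional \<Omega> k)"
proof -
  have "(THE L. dual_sums \<Omega> (\<lambda>j f. s j z * inner_functional \<Omega> (s j) f) L) = inner_functional \<Omega> k"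
  proof (rule the_equality)
    show "dual_sums \<Omega> (\<lambda>j f. s j z * inner_functional \<Omega> (s j) f) (inner_functional \<Omega> k)"
      using k by (simp add: dual_sums_iff basis_A2)
    fix L assume L: "dual_sums \<Omega> (\<lambda>j f. s j z * inner_functional \<Omega> (s j) f) L"
    then have "L \<in> A2_dual \<Omega>" by (simp add: dual_sums_def)
    then obtain g where g: "g \<in> A2 \<Omega>" "L = inner_functional \<Omega> g"
      using Riesz_representation by blast
    then have "A2_sums \<Omega> (\<lambda>j \<xi>. cnj (s j z) * s j \<xi>) g"
      using L by (simp add: dual_sums_iff basis_A2)
    then have "g = k"
      using k(2) A2_cmult[OF basis_A2] by (intro A2_sums_unique)
    then show "L = inner_functional \<Omega> k" using g by simp
  qed
  then show ?thesis by (simp add: bergman_bochner_def)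
qed

lemma bergman_kernel_eq:
  assumes "A2_sums \<Omega> (\<lambda>j \<xi>. cnj (s j z) * s j \<xi>) k"
  shows "bergman_kernel s z \<xi> = cnj (k \<xi>)"
proof -
  have "(\<lambda>j. cnj (s j z) * s j \<xi>) sums k \<xi>"
    using assms A2_cmult[OF basis_A2] by (intro A2_sums_pointwise)
  then have "(\<lambda>j. cnj (cnj (s j z) * s j \<xi>)) sums cnj (k \<xi>)"
    by (simp only: sums_cnj)
  then show ?thesis
    unfolding bergman_kernel_def by (simp add: sums_iff)
qed

end

section \<open>Projectivization and probability densities\<close>

lemma proj_class_iff: "u \<in> proj_class v \<longleftrightarrow> (\<exists>c. c \<noteq> 0 \<and> u = (\<lambda>x. c * v x))"
  unfolding proj_class_def by (simp add: conj_commute)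

lemma proj_class_cmult:
  assumes "c \<noteq> 0"
  shows "proj_class (\<lambda>x. c * v x) = proj_class v"
proof (intro equalityI subsetI)
  fix u assume "u \<in> proj_class (\<lambda>x. c * v x)"
  then obtain d where "d \<noteq> 0" "u = (\<lambda>x. d * (c * v x))"
    unfolding proj_class_iff by (elim exE conjE)
  then have "d * c \<noteq> 0" "u = (\<lambda>x. (d * c) * v x)"
    using assms by (simp_all add: mult.assoc)
  then show "u \<in> proj_class v"
    unfolding proj_class_iff by (intro exI[of _ "d * c"] conjI)
next
  fix u assume "u \<in> proj_class v"
  then obtain d where "d \<noteq> 0" "u = (\<lambda>x. d * v x)"
    unfolding proj_class_iff by (elim exE conjE)
  then have "d / c \<noteq> 0" "u = (\<lambda>x. (d / c) * (c * v x))"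
    using assms by simp_all
  then show "u \<in> proj_class (\<lambda>x. c * v x)"
    unfolding proj_class_iff by (intro exI[of _ "d / c"] conjI)
qed

lemma proj_class_self: "v \<in> proj_class v"
  unfolding proj_class_iff by (intro exI[of _ 1]) simp

lemma proj_class_eqD: "proj_class u = proj_class v \<Longrightarrow> \<exists>c. c \<noteq> 0 \<and> u = (\<lambda>x. c * v x)"
  using proj_class_self[of u] by (simp add: proj_class_iff)

lemma on_classes_proj_class:
  assumes "\<And>c. c \<noteq> 0 \<Longrightarrow> F (\<lambda>x. c * v x) = F v"
  shows "on_classes F (proj_class v) = F v"
proof -
  have "F u = F v" if "u \<in> proj_class v" for u
    using that assms unfolding proj_class_iff by (elim exE conjE) simp
  then have "F ` proj_class v = {F v}"
    using proj_class_self by (intro equalityI subsetI) (auto intro: rev_image_eqI)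
  then show ?thesis by (simp add: on_classes_def)
qed

lemma conj_linear_iso_on_classes:
  assumes J: "conj_linear_iso V W J" and v: "v \<in> V"
  shows "on_classes (\<lambda>v. proj_class (J v)) (proj_class v) = proj_class (J v)"
proof (rule on_classes_proj_class)
  fix c :: complex assume "c \<noteq> 0"
  then show "proj_class (J (\<lambda>x. c * v x)) = proj_class (J v)"
    using J v proj_class_cmult[of "cnj c" "J v"] by (simp add: conj_linear_iso_def)
qed

text \<open>Conjugating a nonzero scalar leaves it nonzero, so conjugate-linearity respects classes.
  Closure of V under scalars keeps 0 and \<open>cnj c\<close> times v in V, where injectivity of J
  can be applied.\<close>

lemma bij_betw_projectivization:
  assumes J: "conj_linear_iso V W J" and V: "\<And>c v. v \<in> V \<Longrightarrow> (\<lambda>x. c * v x) \<in> V"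
  shows "bij_betw (on_classes (\<lambda>v. proj_class (J v))) (projectivization V) (projectivization W)"
proof -
  have inj: "inj_on J V" and im: "J ` V = W"
    and hom: "\<And>c v. v \<in> V \<Longrightarrow> J (\<lambda>x. c * v x) = (\<lambda>y. cnj c * J v y)"
    using J by (auto simp: conj_linear_iso_def bij_betw_def)
  have zero: "J v = (\<lambda>_. 0) \<longleftrightarrow> v = (\<lambda>_. 0)" if v: "v \<in> V" for v
  proof -
    have "J (\<lambda>_. 0) = (\<lambda>_. 0)" "(\<lambda>_. 0) \<in> V"
      using hom[OF v, of 0] V[OF v, of 0] by simp_all
    then show ?thesis using inj v by (metis inj_onD)
  qed
  have nonzero: "J ` (V - {\<lambda>_. 0}) = W - {\<lambda>_. 0}"
    using zero im by (auto simp: image_iff)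
  have "on_classes (\<lambda>v. proj_class (J v)) ` projectivization V
      = (\<lambda>v. proj_class (J v)) ` (V - {\<lambda>_. 0})"
    unfolding projectivization_def image_image
    by (intro image_cong refl conj_linear_iso_on_classes[OF J]) auto
  also have "\<dots> = projectivization W"
    unfolding projectivization_def nonzero[symmetric] image_image ..
  finally have "on_classes (\<lambda>v. proj_class (J v)) ` projectivization V = projectivization W" .
  moreover have "inj_on (on_classes (\<lambda>v. proj_class (J v))) (projectivization V)"
  proof (rule inj_onI)
    fix X Y assume "X \<in> projectivization V" "Y \<in> projectivization V"
      and eq: "on_classes (\<lambda>v. proj_class (J v)) X = on_classes (\<lambda>v. proj_class (J v)) Y"
    then obtain u v where u: "u \<in> V" "X = proj_class u" and v: "v \<in> V" "Y = proj_class v"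
      unfolding projectivization_def by auto
    have "proj_class (J u) = proj_class (J v)"
      using eq u v by (simp add: conj_linear_iso_on_classes[OF J])
    then obtain c where c: "c \<noteq> 0" "J u = (\<lambda>x. c * J v x)"
      using proj_class_eqD by blast
    then have "J u = J (\<lambda>x. cnj c * v x)" using hom[OF v(1), of "cnj c"] by simp
    then have "u = (\<lambda>x. cnj c * v x)"
      using inj u(1) V[OF v(1)] by (auto dest: inj_onD)
    then show "X = Y"
      using u v c proj_class_cmult[of "cnj c" v] by simp
  qed
  ultimately show ?thesis by (simp add: bij_betw_def)
qed

section \<open>Measures attached to projective classes, and the constant functions\<close>

context bergman_space
begin

text \<open>Dividing by the squared norm gives mass one. Positivity is where connectedness enters: a
  nonzero g is nonzero at some point of \<Omega>, as it vanishes outside, so its zero set is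
  null.\<close>

lemma density_in_prob_densities:
  assumes conn: "connected \<Omega>" and g: "g \<in> A2 \<Omega>" and nz: "g \<noteq> (\<lambda>z. 0)"
  shows "density (lebesgue_on \<Omega>) (\<lambda>\<xi>. ennreal ((cmod (g \<xi>))\<^sup>2 / (L2_norm_on \<Omega> g)\<^sup>2)) \<in> prob_densities \<Omega>"
proof -
  define \<rho> where "\<rho> = (\<lambda>\<xi>. (cmod (g \<xi>))\<^sup>2 / (L2_norm_on \<Omega> g)\<^sup>2)"
  have norm: "L2_norm_on \<Omega> g \<noteq> 0"
    using norm_eq_0D[OF g] nz by blast
  have int: "integrable (lebesgue_on \<Omega>) \<rho>"
    unfolding \<rho>_def using g by (intro integrable_divide) (simp add: A2_def)
  have "integral\<^sup>L (lebesgue_on \<Omega>) \<rho> = 1"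
    using norm unfolding \<rho>_def integral_divide_zero by (simp add: L2_norm_on_def)
  then have mass: "(\<integral>\<^sup>+\<xi>. ennreal (\<rho> \<xi>) \<partial>lebesgue_on \<Omega>) = 1"
    using int by (subst nn_integral_eq_integral) (auto simp: \<rho>_def)
  let ?M = "density (lebesgue_on \<Omega>) (\<lambda>\<xi>. ennreal (\<rho> \<xi>))"
  have "emeasure ?M (space ?M) = (\<integral>\<^sup>+\<xi>. ennreal (\<rho> \<xi>) * indicator (space ?M) \<xi> \<partial>lebesgue_on \<Omega>)"
    using borel_measurable_integrable[OF int] sets.top[of ?M] by (intro emeasure_density) simp_all
  also have "\<dots> = 1"
    unfolding mass[symmetric] by (rule nn_integral_cong) simp
  finally have prob: "prob_space ?M"
    by (rule prob_spaceI)
  obtain z0 where "g z0 \<noteq> 0" using nz by auto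
  then have "z0 \<in> \<Omega>" using A2_D(3)[OF g] by blast
  then have "negligible {z \<in> \<Omega>. g z = 0}"
    using negligible_zero_set[OF open_domain conn A2_D(1)[OF g]] \<open>g z0 \<noteq> 0\<close> by blast
  then have "AE \<xi> in lebesgue. \<xi> \<notin> {z \<in> \<Omega>. g z = 0}"
    by (intro AE_not_in) (simp add: negligible_iff_null_sets)
  then have "AE \<xi> in lebesgue_on \<Omega>. \<rho> \<xi> > 0"
    using open_domain norm by (subst AE_restrict_space_iff) (auto simp: \<rho>_def elim!: eventually_mono)
  then show ?thesis
    using prob int unfolding prob_densities_def \<rho>_def
    by (intro CollectI conjI exI[of _ "\<lambda>\<xi>. (cmod (g \<xi>))\<^sup>2 / (L2_norm_on \<Omega> g)\<^sup>2"] refl)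
qed

lemma phi_map_proj_class:
  assumes g: "g \<in> A2 \<Omega>"
  shows "phi_map \<Omega> (proj_class g)
    = density (lebesgue_on \<Omega>) (\<lambda>\<xi>. ennreal ((cmod (g \<xi>))\<^sup>2 / (L2_norm_on \<Omega> g)\<^sup>2))"
  unfolding phi_map_def
  by (rule on_classes_proj_class) (simp add: norm_cmult norm_mult power_mult_distrib)

text \<open>The constant 1, extended by 0, serves as a test function: every evaluation at a point of
  \<Omega> takes the value 1 on it. Boundedness gives its square integrability.\<close>

lemma indicator_in_A2:
  assumes "bounded \<Omega>"
  shows "indicator \<Omega> \<in> A2 \<Omega>"
proof -
  have "holomorphic_Cn (indicator \<Omega>) \<Omega>"
    unfolding holomorphic_Cn_def
  proof
    fix z assume "z \<in> \<Omega>"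
    have "((\<lambda>z. 1::complex) has_derivative (\<lambda>v. 0)) (at z)" by simp
    then have "(indicator \<Omega> has_derivative (\<lambda>v. 0::complex)) (at z)"
      by (rule has_derivative_transform_within_open[OF _ open_domain \<open>z \<in> \<Omega>\<close>]) simp
    then show "\<exists>f'. (indicator \<Omega> has_derivative f') (at z) \<and> (\<forall>c v. f' (c *s v) = c * (f' v :: complex))"
      by (intro exI[of _ "\<lambda>v. 0"]) simp
  qed
  moreover have "integrable lborel (\<lambda>z. (cmod (indicator \<Omega> z))\<^sup>2)"
  proof -
    have "(\<lambda>z. (cmod (indicator \<Omega> z))\<^sup>2) = indicator \<Omega>"
      by (auto simp: indicator_def)
    moreover have "emeasure lborel \<Omega> < \<infinity>"
      using assms open_domain by (intro emeasure_bounded_finite)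
    ultimately show ?thesis
      using open_domain by simp
  qed
  ultimately show ?thesis
    unfolding A2_iff by simp
qed

end

theorem proposition3p8:
  fixes \<Omega> :: "(complex ^ 'n) set" and s :: "nat \<Rightarrow> complex ^ 'n \<Rightarrow> complex"
  assumes "domain_Cn \<Omega>" and "bounded \<Omega>"
    and "orthonormal_basis_A2 \<Omega> s"
  shows "Phi_map \<Omega> s \<in> \<Omega> \<rightarrow> prob_densities \<Omega> \<and>
         bergman_bochner \<Omega> s \<in> \<Omega> \<rightarrow> projectivization (A2_dual \<Omega>) \<and>
         conj_linear_iso (A2_dual \<Omega>) (A2 \<Omega>) (dual_iso \<Omega> s) \<and>
         bij_betw (varphi_map \<Omega> s) (projectivization (A2_dual \<Omega>)) (projectivization (A2 \<Omega>)) \<and>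
         phi_map \<Omega> \<in> projectivization (A2 \<Omega>) \<rightarrow> prob_densities \<Omega> \<and>
         (\<forall>z\<in>\<Omega>. Phi_map \<Omega> s z = (phi_map \<Omega> \<circ> varphi_map \<Omega> s \<circ> bergman_bochner \<Omega> s) z)"
proof -
  have "open \<Omega>" and conn: "connected \<Omega>"
    using assms(1) by (auto simp: domain_Cn_def)
  interpret bergman_basis \<Omega> s
    by unfold_locales fact+
  have bij: "bij_betw (varphi_map \<Omega> s) (projectivization (A2_dual \<Omega>)) (projectivization (A2 \<Omega>))"
    unfolding varphi_map_def
    by (rule bij_betw_projectivization[OF conj_linear_iso_dual_iso A2_dual_cmult])
  have phi: "phi_map \<Omega> \<in> projectivization (A2 \<Omega>) \<rightarrow> prob_densities \<Omega>"
  proof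
    fix X assume "X \<in> projectivization (A2 \<Omega>)"
    then obtain g where "g \<in> A2 \<Omega> - {\<lambda>_. 0}" "X = proj_class g"
      unfolding projectivization_def by (elim imageE)
    then show "phi_map \<Omega> X \<in> prob_densities \<Omega>"
      using density_in_prob_densities[OF conn, of g] by (simp add: phi_map_proj_class)
  qed
  have bb: "bergman_bochner \<Omega> s z \<in> projectivization (A2_dual \<Omega>)"
    and comp: "Phi_map \<Omega> s z = phi_map \<Omega> (varphi_map \<Omega> s (bergman_bochner \<Omega> s z))" if z: "z \<in> \<Omega>" for z
  proof -
    obtain k where k: "k \<in> A2 \<Omega>" "\<And>f. f \<in> A2 \<Omega> \<Longrightarrow> A2_inner \<Omega> f k = f z"
      "A2_sums \<Omega> (\<lambda>j \<xi>. cnj (s j z) * s j \<xi>) k"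
      using evaluation_representer[OF z] by metis
    let ?L = "inner_functional \<Omega> k"
    note bb_eq = bergman_bochner_eq[OF k(1,3)]
    have L: "?L \<in> A2_dual \<Omega>" using k(1) by (rule inner_functional_in_dual)
    have "?L (indicator \<Omega>) = 1"
      using k(2) indicator_in_A2[OF assms(2)] z by simp
    then have "?L \<noteq> (\<lambda>_. 0)" by (metis zero_neq_one)
    then show "bergman_bochner \<Omega> s z \<in> projectivization (A2_dual \<Omega>)"
      using L unfolding bb_eq projectivization_def by blast
    have "varphi_map \<Omega> s (bergman_bochner \<Omega> s z) = proj_class k"
      unfolding bb_eq varphi_map_def conj_linear_iso_on_classes[OF conj_linear_iso_dual_iso L]
      by (simp add: dual_iso_inner_functional k(1))
    \<comment> \<open>The reproducing identity applied to k itself makes the denominators of both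
      densities agree; the numerators agree because the kernel and k differ by a
      conjugation.\<close>
    moreover have "k z = of_real ((L2_norm_on \<Omega> k)\<^sup>2)"
      using inner_self[OF k(1)] k(1,2) by simp
    then have "Re (bergman_kernel s z z) = (L2_norm_on \<Omega> k)\<^sup>2"
      by (simp add: bergman_kernel_eq[OF k(3)] del: of_real_power)
    ultimately show "Phi_map \<Omega> s z = phi_map \<Omega> (varphi_map \<Omega> s (bergman_bochner \<Omega> s z))"
      by (simp add: phi_map_proj_class k(1) Phi_map_def bergman_kernel_eq[OF k(3)])
  qed
  have "Phi_map \<Omega> s \<in> \<Omega> \<rightarrow> prob_densities \<Omega>"
  proof
    fix z assume z: "z \<in> \<Omega>"
    show "Phi_map \<Omega> s z \<in> prob_densities \<Omega>"
      unfolding comp[OF z] by (rule funcset_mem[OF phi bij_betw_apply[OF bij bb[OF z]]])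
  qed
  then show ?thesis
    using bb comp phi bij conj_linear_iso_dual_iso by auto
qed

end
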